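(* For any real numbers $b$, $\delta$ with $0<\delta\le\frac12$, and $\kappa_0$, there exists a positive constant $C=C(b,\delta,\kappa_0)$ such that the following holds: if a knot $K\subset\mathbb{R}^3$ with length $l(K)$ whose curvature is not greater than $\kappa_0$ has a pair of points $x,y$ on it which satisfy $\delta_K(x,y)=\delta\, l(K)$ and $|x-y|\le C\,l(K)$, then $E_{|\sin\theta|}(K)\ge b$.
   Context: A knot $K$ is the image of an embedding $f:S^1\to\mathbb{R}^3$ of class $C^2$, parametrized by arc-length. $\delta_K(x,y)$ denotes the shorter arc-length along $K$ between $x,y\in K$. For distinct points $x,y\in K$, let $C(x,x,y)$ be the circle (a line being allowed) tangent to $K$ at $x$ and passing through $y$, oriented by the orientation of $K$ at $x$, and let $C(y,y,x)$ be defined similarly with the roles of $x,y$ exchanged. The conformal angle $\theta=\theta_K(x,y)\in[0,\pi]$ is the angle between $C(x,x,y)$ and $C(y,y,x)$ at $x$ (equivalently at $y$). The absolute imaginary cross-ratio energy is $$E_{|\sin\theta|}(K)=\iint_{K\times K\setminus\triangle}\frac{|\sin\theta_K(x,y)|}{|x-y|^2}\,dx\,dy\in[0,\infty],$$ where $dx,dy$ are arc-length elements and $\triangle$ is the diagonal. *)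

theory Defs
  imports "HOL-Analysis.Analysis"
begin

text \<open>
  A knot of length \<open>l\<close> is represented by an \<open>l\<close>-periodic arc-length parametrization \<open>f\<close>, i.e. by a
  unit-speed \<open>C\<^sup>2\<close> embedding of the circle \<open>\<real> / l\<int>\<close>. By compactness, an injective continuous map of
  the circle is a homeomorphism onto its image; the knot itself is the image of \<open>f\<close>.
\<close>

definition C2_curve :: "(real \<Rightarrow> real ^ 3) \<Rightarrow> bool" where
  "C2_curve f \<longleftrightarrow>
     (\<exists>f' f''. (\<forall>s. (f has_vector_derivative f' s) (at s)) \<and>
              (\<forall>s. (f' has_vector_derivative f'' s) (at s)) \<and>
              continuous_on UNIV f'')"

definition unit_tangent :: "(real \<Rightarrow> real ^ 3) \<Rightarrow> real \<Rightarrow> real ^ 3" where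
  "unit_tangent f s = vector_derivative f (at s)"

definition arclength_knot :: "real \<Rightarrow> (real \<Rightarrow> real ^ 3) \<Rightarrow> bool" where
  "arclength_knot l f \<longleftrightarrow>
     l > 0 \<and> C2_curve f \<and> (\<forall>s. norm (unit_tangent f s) = 1) \<and>
     (\<forall>s. f (s + l) = f s) \<and> inj_on f {0..<l}"

definition curvature :: "(real \<Rightarrow> real ^ 3) \<Rightarrow> real \<Rightarrow> real" where
  "curvature f s = norm (vector_derivative (unit_tangent f) (at s))"

text \<open>
  The length of the shorter of the two arcs of the knot joining \<open>f s\<close> and \<open>f t\<close>, for
  parameters \<open>s, t\<close> in the fundamental domain \<open>{0..<l}\<close>.
\<close>

definition arc_dist :: "real \<Rightarrow> real \<Rightarrow> real \<Rightarrow> real" where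
  "arc_dist l s t = min \<bar>s - t\<bar> (l - \<bar>s - t\<bar>)"

text \<open>
  An oriented circle or line in space is represented by the set of pairs (point, positive unit
  tangent at that point).
\<close>

definition oriented_circle :: "((real ^ 3) \<times> (real ^ 3)) set \<Rightarrow> bool" where
  "oriented_circle C \<longleftrightarrow>
     (\<exists>a r u w. r > 0 \<and> norm u = 1 \<and> norm w = 1 \<and> u \<bullet> w = 0 \<and>
        C = range (\<lambda>\<tau>. (a + r *\<^sub>R (cos \<tau> *\<^sub>R u + sin \<tau> *\<^sub>R w),
                         - sin \<tau> *\<^sub>R u + cos \<tau> *\<^sub>R w))) \<or>
     (\<exists>a v. norm v = 1 \<and> C = range (\<lambda>\<tau>. (a + \<tau> *\<^sub>R v, v)))"

text \<open>
  The circle through \<open>q\<close> that is tangent at \<open>p\<close> to, and oriented by, the unit vector \<open>v\<close>. It is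
  well defined for \<open>p \<noteq> q\<close> by the lemma \<open>tangent_circle_ex1\<close> below.
\<close>

definition tangent_circle :: "real ^ 3 \<Rightarrow> real ^ 3 \<Rightarrow> real ^ 3 \<Rightarrow> ((real ^ 3) \<times> (real ^ 3)) set" where
  "tangent_circle p v q = (THE C. oriented_circle C \<and> (p, v) \<in> C \<and> q \<in> fst ` C)"

definition circle_direction :: "((real ^ 3) \<times> (real ^ 3)) set \<Rightarrow> real ^ 3 \<Rightarrow> real ^ 3" where
  "circle_direction C p = (THE w. (p, w) \<in> C)"

text \<open>Both directions are unit vectors, so \<open>arccos\<close> of their inner product is the angle in \<open>[0, \<pi>]\<close>.\<close>

definition circle_angle ::
  "((real ^ 3) \<times> (real ^ 3)) set \<Rightarrow> ((real ^ 3) \<times> (real ^ 3)) set \<Rightarrow> real ^ 3 \<Rightarrow> real" where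
  "circle_angle C D p = arccos (circle_direction C p \<bullet> circle_direction D p)"

definition conformal_angle :: "(real \<Rightarrow> real ^ 3) \<Rightarrow> real \<Rightarrow> real \<Rightarrow> real" where
  "conformal_angle f s t =
     circle_angle (tangent_circle (f s) (unit_tangent f s) (f t))
                  (tangent_circle (f t) (unit_tangent f t) (f s)) (f s)"

definition abs_imaginary_cross_ratio_energy :: "real \<Rightarrow> (real \<Rightarrow> real ^ 3) \<Rightarrow> ennreal" where
  "abs_imaginary_cross_ratio_energy l f =
     (\<integral>\<^sup>+ z \<in> ({0..<l} \<times> {0..<l}) - {(s, t). s = t}.
        ennreal (case z of (s, t) \<Rightarrow> \<bar>sin (conformal_angle f s t)\<bar> / (norm (f s - f t))\<^sup>2)
      \<partial>(lborel \<Otimes>\<^sub>M lborel))"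

lemma oriented_circle_at:
  assumes "oriented_circle C" "(p, v) \<in> C"
  shows "norm v = 1 \<and>
    (C = range (\<lambda>\<tau>. (p + \<tau> *\<^sub>R v, v)) \<or>
     (\<exists>r n. r > 0 \<and> norm n = 1 \<and> v \<bullet> n = 0 \<and>
        C = range (\<lambda>\<tau>. (p + (r * sin \<tau>) *\<^sub>R v + (r * (1 - cos \<tau>)) *\<^sub>R n,
                         cos \<tau> *\<^sub>R v + sin \<tau> *\<^sub>R n))))"
  using assms(1) unfolding oriented_circle_def
proof (elim disjE exE conjE)
  fix a v' assume v': "norm v' = 1" and C: "C = range (\<lambda>\<tau>. (a + \<tau> *\<^sub>R v', v'))"
  obtain \<sigma> where p: "p = a + \<sigma> *\<^sub>R v'" and v: "v = v'" using assms(2) C by auto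
  have "C = range ((\<lambda>\<tau>. (a + \<tau> *\<^sub>R v', v')) \<circ> (\<lambda>\<tau>. \<sigma> + \<tau>))"
    unfolding C image_comp[symmetric] surj_plus ..
  also have "\<dots> = range (\<lambda>\<tau>. (p + \<tau> *\<^sub>R v, v))"
    by (simp add: p v o_def algebra_simps)
  finally show ?thesis using v v' by simp
next
  fix a r u w
  assume r: "0 < r" and u: "norm u = 1" and w: "norm w = 1" and uw: "u \<bullet> w = 0"
    and C: "C = range (\<lambda>\<tau>. (a + r *\<^sub>R (cos \<tau> *\<^sub>R u + sin \<tau> *\<^sub>R w),
                            - sin \<tau> *\<^sub>R u + cos \<tau> *\<^sub>R w))"
  obtain \<sigma> where p: "p = a + r *\<^sub>R (cos \<sigma> *\<^sub>R u + sin \<sigma> *\<^sub>R w)"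
    and v: "v = - sin \<sigma> *\<^sub>R u + cos \<sigma> *\<^sub>R w" using assms(2) C by auto
  define n where "n = - cos \<sigma> *\<^sub>R u - sin \<sigma> *\<^sub>R w"
  have uu: "u \<bullet> u = 1" "w \<bullet> w = 1" "w \<bullet> u = 0"
    using u w uw by (simp_all add: norm_eq_1 inner_commute)
  have sc: "sin \<sigma> * sin \<sigma> = 1 - cos \<sigma> * cos \<sigma>"
    using sin_squared_eq[of \<sigma>] by (simp add: power2_eq_square)
  have "v \<bullet> v = 1" "n \<bullet> n = 1" "v \<bullet> n = 0"
    unfolding v n_def by (simp_all add: inner_simps uu uw sc)
  then have n: "norm v = 1" "norm n = 1" "v \<bullet> n = 0" by (simp_all add: norm_eq_1)
  have "C = range ((\<lambda>\<tau>. (a + r *\<^sub>R (cos \<tau> *\<^sub>R u + sin \<tau> *\<^sub>R w),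
                  - sin \<tau> *\<^sub>R u + cos \<tau> *\<^sub>R w)) \<circ> (\<lambda>\<tau>. \<sigma> + \<tau>))"
    unfolding C image_comp[symmetric] surj_plus ..
  moreover have "(\<lambda>\<tau>. (a + r *\<^sub>R (cos \<tau> *\<^sub>R u + sin \<tau> *\<^sub>R w),
                  - sin \<tau> *\<^sub>R u + cos \<tau> *\<^sub>R w)) \<circ> (\<lambda>\<tau>. \<sigma> + \<tau>) =
      (\<lambda>\<tau>. (p + (r * sin \<tau>) *\<^sub>R v + (r * (1 - cos \<tau>)) *\<^sub>R n, cos \<tau> *\<^sub>R v + sin \<tau> *\<^sub>R n))"
    unfolding p v n_def by (auto simp: fun_eq_iff cos_add sin_add algebra_simps)
  ultimately have "C = range (\<lambda>\<tau>. (p + (r * sin \<tau>) *\<^sub>R v + (r * (1 - cos \<tau>)) *\<^sub>R n,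
                         cos \<tau> *\<^sub>R v + sin \<tau> *\<^sub>R n))" by (simp only:)
  with n r show ?thesis by blast
qed

lemma circle_direction_eq:
  assumes "oriented_circle C" "(p, v) \<in> C"
  shows "circle_direction C p = v"
  unfolding circle_direction_def
proof (rule the_equality)
  fix w assume w: "(p, w) \<in> C"
  from oriented_circle_at[OF assms]
  show "w = v"
  proof (elim conjE disjE exE)
    fix r n assume r: "norm v = 1" "0 < r" "norm n = 1" "v \<bullet> n = 0"
      and C: "C = range (\<lambda>\<tau>. (p + (r * sin \<tau>) *\<^sub>R v + (r * (1 - cos \<tau>)) *\<^sub>R n,
                              cos \<tau> *\<^sub>R v + sin \<tau> *\<^sub>R n))"
    obtain \<tau> where 1: "(r * sin \<tau>) *\<^sub>R v + (r * (1 - cos \<tau>)) *\<^sub>R n = 0"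
      and 2: "w = cos \<tau> *\<^sub>R v + sin \<tau> *\<^sub>R n" using w C by auto
    have "((r * sin \<tau>) *\<^sub>R v + (r * (1 - cos \<tau>)) *\<^sub>R n) \<bullet> v = r * sin \<tau>"
         "((r * sin \<tau>) *\<^sub>R v + (r * (1 - cos \<tau>)) *\<^sub>R n) \<bullet> n = r * (1 - cos \<tau>)"
      using r by (simp_all add: inner_simps norm_eq_1 inner_commute)
    then have "sin \<tau> = 0" "cos \<tau> = 1" using r unfolding 1 by simp_all
    then show ?thesis using 2 by simp
  qed (use w in auto)
qed (use assms in simp)

lemma oriented_circle_through:
  assumes C: "oriented_circle C" "(p, v) \<in> C" "(q, w) \<in> C" and pq: "p \<noteq> q"
  defines "d \<equiv> q - p"
  defines "e \<equiv> d - (d \<bullet> v) *\<^sub>R v"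
  shows "w = (2 * (d \<bullet> v) / (d \<bullet> d)) *\<^sub>R d - v \<and>
    C = (if e = 0 then range (\<lambda>\<tau>. (p + \<tau> *\<^sub>R v, v)) else
      (let r = (d \<bullet> d) / (2 * norm e); n = e /\<^sub>R norm e in
       range (\<lambda>\<tau>. (p + (r * sin \<tau>) *\<^sub>R v + (r * (1 - cos \<tau>)) *\<^sub>R n,
                    cos \<tau> *\<^sub>R v + sin \<tau> *\<^sub>R n))))"
  using oriented_circle_at[OF C(1,2)]
proof (elim conjE disjE exE)
  assume v: "norm v = 1" and Ceq: "C = range (\<lambda>\<tau>. (p + \<tau> *\<^sub>R v, v))"
  obtain \<tau> where "q = p + \<tau> *\<^sub>R v" and w: "w = v" using C(3) Ceq by auto
  then have d: "d = \<tau> *\<^sub>R v" by (simp add: d_def)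
  have "\<tau> \<noteq> 0" using d pq d_def by auto
  have "v \<bullet> v = 1" using v by (simp add: norm_eq_1)
  then have "e = 0" "2 * (d \<bullet> v) / (d \<bullet> d) = 2 / \<tau>"
    using \<open>\<tau> \<noteq> 0\<close> by (simp_all add: e_def d)
  moreover have "(2 / \<tau>) *\<^sub>R d - v = v"
    using \<open>\<tau> \<noteq> 0\<close> by (simp add: d vec_eq_iff)
  ultimately show ?thesis using w Ceq by simp
next
  fix r n assume r: "norm v = 1" "0 < r" "norm n = 1" "v \<bullet> n = 0"
    and Ceq: "C = range (\<lambda>\<tau>. (p + (r * sin \<tau>) *\<^sub>R v + (r * (1 - cos \<tau>)) *\<^sub>R n,
                              cos \<tau> *\<^sub>R v + sin \<tau> *\<^sub>R n))"
  obtain \<tau> where d: "d = (r * sin \<tau>) *\<^sub>R v + (r * (1 - cos \<tau>)) *\<^sub>R n"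
    and w: "w = cos \<tau> *\<^sub>R v + sin \<tau> *\<^sub>R n" using C(3) Ceq d_def by auto
  have rr: "v \<bullet> v = 1" "n \<bullet> n = 1" "n \<bullet> v = 0"
    using r by (simp_all add: norm_eq_1 inner_commute)
  have sc: "sin \<tau> * sin \<tau> = 1 - cos \<tau> * cos \<tau>"
    using sin_squared_eq[of \<tau>] by (simp add: power2_eq_square)
  have dv: "d \<bullet> v = r * sin \<tau>" unfolding d by (simp add: inner_simps rr)
  have "d \<bullet> d = r * r * (sin \<tau> * sin \<tau>) + r * r * (1 - cos \<tau>) * (1 - cos \<tau>)"
    unfolding d by (simp add: inner_simps rr r algebra_simps)
  also have "\<dots> = 2 * r * r * (1 - cos \<tau>)" unfolding sc by (simp add: algebra_simps)
  finally have dd: "d \<bullet> d = 2 * r * r * (1 - cos \<tau>)" .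
  have "d \<bullet> d \<noteq> 0" using pq d_def by simp
  then have "cos \<tau> \<noteq> 1" using dd by auto
  then have c: "1 - cos \<tau> > 0" using cos_le_one[of \<tau>] by linarith
  have e: "e = (r * (1 - cos \<tau>)) *\<^sub>R n" unfolding e_def dv by (simp add: d)
  then have ne: "norm e = r * (1 - cos \<tau>)" using r c by simp
  then have e0: "e \<noteq> 0" using r c by auto
  have "norm e \<noteq> 0" using e0 by simp
  moreover have "e = norm e *\<^sub>R n" unfolding ne by (rule e)
  ultimately have "e /\<^sub>R norm e = n" by (metis scaleR_scaleR left_inverse scaleR_one)
  moreover have "(d \<bullet> d) / (2 * norm e) = r"
    unfolding ne dd using r c by simp
  moreover have "w = (2 * (d \<bullet> v) / (d \<bullet> d)) *\<^sub>R d - v"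
  proof -
    have k: "2 * (d \<bullet> v) / (d \<bullet> d) = sin \<tau> / (r * (1 - cos \<tau>))"
      unfolding dv dd using r c by (simp add: field_simps)
    have "(sin \<tau> / (r * (1 - cos \<tau>))) *\<^sub>R d =
        (sin \<tau> * sin \<tau> / (1 - cos \<tau>)) *\<^sub>R v + sin \<tau> *\<^sub>R n"
      unfolding d using r c by (simp add: scaleR_add_right)
    also have "sin \<tau> * sin \<tau> / (1 - cos \<tau>) = 1 + cos \<tau>"
      unfolding sc using c by (simp add: field_simps)
    finally show ?thesis unfolding k w by (simp add: algebra_simps)
  qed
  ultimately show ?thesis using e0 Ceq by (simp add: Let_def)
qed

lemma tangent_circle_ex1:
  assumes v: "norm v = 1" and pq: "p \<noteq> q"
  shows "\<exists>!C. oriented_circle C \<and> (p, v) \<in> C \<and> q \<in> fst ` C"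
proof (rule ex_ex1I)
  define d where "d = q - p"
  define e where "e = d - (d \<bullet> v) *\<^sub>R v"
  have vv: "v \<bullet> v = 1" using v by (simp add: norm_eq_1)
  have d0: "d \<bullet> d > 0" using pq d_def by simp
  have ve: "e \<bullet> v = 0" "v \<bullet> e = 0"
    by (simp_all add: e_def inner_simps vv inner_commute)
  have d: "d = (d \<bullet> v) *\<^sub>R v + e" by (simp add: e_def)
  have qe: "q = p + (d \<bullet> v) *\<^sub>R v + e" by (simp add: e_def d_def)
  show "\<exists>C. oriented_circle C \<and> (p, v) \<in> C \<and> q \<in> fst ` C"
  proof (cases "e = 0")
    case True
    have "oriented_circle (range (\<lambda>\<tau>. (p + \<tau> *\<^sub>R v, v)))"
      unfolding oriented_circle_def using v by blast
    moreover have "(p, v) \<in> range (\<lambda>\<tau>. (p + \<tau> *\<^sub>R v, v))"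
      by (rule range_eqI[of _ _ 0]) simp
    moreover have "(q, v) \<in> range (\<lambda>\<tau>. (p + \<tau> *\<^sub>R v, v))"
      by (rule range_eqI[of _ _ "d \<bullet> v"]) (use True qe in simp)
    ultimately show ?thesis by (metis fst_conv image_eqI)
  next
    case False
    define r n where "r = (d \<bullet> d) / (2 * norm e)" and "n = e /\<^sub>R norm e"
    have r: "r > 0" using d0 False by (simp add: r_def)
    have n: "norm n = 1" "v \<bullet> n = 0" "n \<bullet> v = 0" and en: "norm e *\<^sub>R n = e"
      using False ve by (simp_all add: n_def)
    have "d \<bullet> d = (d \<bullet> v)\<^sup>2 + (norm e)\<^sup>2"
      by (subst (1 2) d) (simp add: inner_simps vv ve power2_norm_eq_inner, simp add: power2_eq_square)
    moreover have "d \<bullet> d = 2 * r * norm e" using False by (simp add: r_def)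
    ultimately have "(d \<bullet> v)\<^sup>2 + (norm e)\<^sup>2 = 2 * r * norm e" by simp
    then have "((r - norm e) / r)\<^sup>2 + ((d \<bullet> v) / r)\<^sup>2 = 1"
      using r by (simp add: power_divide add_divide_distrib[symmetric] power2_eq_square algebra_simps)
    then obtain \<tau> where \<tau>: "(r - norm e) / r = cos \<tau>" "(d \<bullet> v) / r = sin \<tau>"
      using sincos_total_2pi by metis
    have q: "q = p + (r * sin \<tau>) *\<^sub>R v + (r * (1 - cos \<tau>)) *\<^sub>R n"
    proof -
      have "r * sin \<tau> = d \<bullet> v" "r * (1 - cos \<tau>) = norm e"
        using r unfolding \<tau>[symmetric] by (simp_all add: field_simps)
      then show ?thesis using qe en by simp
    qed
    define g where "g = (\<lambda>\<tau>. ((p + r *\<^sub>R n) + r *\<^sub>R (cos \<tau> *\<^sub>R (- n) + sin \<tau> *\<^sub>R v),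
                    - sin \<tau> *\<^sub>R (- n) + cos \<tau> *\<^sub>R v))"
    have "oriented_circle (range g)"
      unfolding oriented_circle_def g_def
      using r n v by (intro disjI1 exI[of _ "p + r *\<^sub>R n"] exI[of _ r] exI[of _ "- n"] exI[of _ v]) simp
    moreover have "g 0 = (p, v)" by (simp add: g_def)
    moreover have "fst (g \<tau>) = q" unfolding q by (simp add: g_def algebra_simps)
    ultimately show ?thesis by (metis image_eqI rangeI)
  qed
next
  fix C D
  assume "oriented_circle C \<and> (p, v) \<in> C \<and> q \<in> fst ` C" "oriented_circle D \<and> (p, v) \<in> D \<and> q \<in> fst ` D"
  then obtain w w' where "oriented_circle C" "(p, v) \<in> C" "(q, w) \<in> C"
    "oriented_circle D" "(p, v) \<in> D" "(q, w') \<in> D" by auto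
  from oriented_circle_through[OF this(1-3) pq, THEN conjunct2]
    oriented_circle_through[OF this(4-6) pq, THEN conjunct2]
  show "C = D" by simp
qed

lemma conformal_angle_eq:
  assumes "norm (unit_tangent f s) = 1" "norm (unit_tangent f t) = 1" "f s \<noteq> f t"
  shows "conformal_angle f s t =
    (let d = f s - f t; v = unit_tangent f t in
     arccos (unit_tangent f s \<bullet> ((2 * (d \<bullet> v) / (d \<bullet> d)) *\<^sub>R d - v)))"
proof -
  let ?C = "tangent_circle (f s) (unit_tangent f s) (f t)"
  let ?D = "tangent_circle (f t) (unit_tangent f t) (f s)"
  have C: "oriented_circle ?C \<and> (f s, unit_tangent f s) \<in> ?C \<and> f t \<in> fst ` ?C"
    unfolding tangent_circle_def by (rule theI'[OF tangent_circle_ex1]) (use assms in auto)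
  have D: "oriented_circle ?D \<and> (f t, unit_tangent f t) \<in> ?D \<and> f s \<in> fst ` ?D"
    unfolding tangent_circle_def by (rule theI'[OF tangent_circle_ex1]) (use assms in auto)
  then obtain w where w: "(f s, w) \<in> ?D" by auto
  have "w = (2 * ((f s - f t) \<bullet> unit_tangent f t) / ((f s - f t) \<bullet> (f s - f t))) *\<^sub>R (f s - f t)
      - unit_tangent f t"
    using oriented_circle_through[of ?D "f t" "unit_tangent f t" "f s" w] D w assms(3) by auto
  moreover have "circle_direction ?C (f s) = unit_tangent f s" "circle_direction ?D (f s) = w"
    using C D w by (auto intro: circle_direction_eq)
  ultimately show ?thesis
    by (simp add: conformal_angle_def circle_angle_def Let_def)
qed

end

theory Submission
  imports Defs
begin

text \<open>
  The idea is to look at the knot from one of its points \<open>f s\<close> through the inversion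
  \<open>t \<mapsto> (f t - f s) / |f t - f s|\<^sup>2\<close>. The inverted knot has speed \<open>1 / |f t - f s|\<^sup>2\<close>, and its velocity
  makes the angle \<open>\<theta>\<close> (up to orientation) with the tangent of the knot at \<open>f s\<close>. Hence
  \<open>|sin \<theta>| / |f s - f t|\<^sup>2\<close> is the speed of the projection of the inverted knot to the plane normal to
  that tangent, and the inner integral over \<open>t\<close>, called \<open>point_energy s\<close> below, is at least the distance
  between any two points of the projected inverted knot (\<open>half_curvature_variation\<close>). In other
  words: if \<open>point_energy s\<close> is small, then the whole inverted knot runs in a thin straight tube. The
  energy itself is the integral of \<open>point_energy\<close>, the mass that \<open>energy_measure\<close> gives to one period
  (\<open>energy_eq_energy_measure\<close>).

  The point at infinity of the tube corresponds to \<open>t \<rightarrow> s\<close>, where the projection tends to half the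
  curvature vector at \<open>s\<close>. Comparing it with the projection of another point \<open>q\<close> of the knot gives a
  differential inequality for the distance \<open>\<phi>(s) = |f s - q|\<close>: up to an error of integral at most
  twice the energy, \<open>\<phi>\<close> solves the equation \<open>\<phi>'' = - (1 - \<phi>'\<^sup>2) / \<phi>\<close> that holds when \<open>f\<close> runs along a
  circle through \<open>q\<close>. With a small error, such a positive \<open>\<phi>\<close> cannot turn
  from clearly decreasing to clearly increasing. So on an arc of
  length \<open>2 L\<close> with energy at most \<open>1 / 100\<close>, the midpoint has distance at least \<open>L / 7\<close> from
  every point outside the arc (\<open>repulsion\<close>).

  Now let \<open>f s0\<close> and \<open>f t0\<close> be at distance at most \<open>r\<close>, far apart along the knot. Consider the
  three strands that leave \<open>f s0\<close> forwards, \<open>f s0\<close> backwards and \<open>f t0\<close> forwards, at arc-length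
  between \<open>r\<close> and \<open>10000 r\<close>. If they had very small energy, they would repel each other linearly in
  the arc-length. But seen from some point of small \<open>point_energy\<close> on the first strand, at arc-length
  between \<open>2500 r\<close> and \<open>5000 r\<close> from \<open>f s0\<close>, all three strands start close together in one thin tube; two of them
  leave in the same direction of the tube and hence come too close to each other
  (\<open>three_strands_in_tube_False\<close>). Therefore each such range of scales carries a fixed amount of energy
  (\<open>window_energy\<close>). Between the scales \<open>C l\<close> and \<open>\<delta> l / 2\<close> there is room for \<open>N\<close> disjoint ranges as
  soon as \<open>C\<close> is of the order \<open>\<delta> / 20000\<^sup>N\<close> (\<open>many_windows_energy\<close>), and \<open>N\<close> is chosen from \<open>b\<close>.
\<close>

section \<open>Almost concave functions\<close>

text \<open>
  For \<open>\<rho> = 0\<close> the hypothesis \<open>ode\<close> reads \<open>\<phi>'' \<le> - (1 - \<phi>'\<^sup>2) / \<phi>\<close>, with equality for the distance of a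
  point moving on a circle from a fixed point of that circle. Since \<open>\<phi>'\<close> can gain at most \<open>\<eta>\<close>, a
  function that is not increasing at \<open>m\<close> stays below \<open>H = \<phi> m + L / 50\<close>. While the slope is above
  \<open>-1/2\<close>, it falls at rate at least \<open>3 / (4 H)\<close>, so it drops below \<open>-1/2\<close> within time \<open>2 H\<close>; from then on
  \<open>\<phi>\<close> decreases at rate at least \<open>1/4\<close> and would reach 0 by time \<open>6 H\<close>.
\<close>
lemma almost_concave_lower_bound_right:
  fixes \<phi> \<psi> \<psi>' \<rho> :: "real \<Rightarrow> real"
  assumes L: "L > 0" and \<eta>: "\<eta> \<le> 1 / 50"
    and pos: "\<And>s. s \<in> {m..m+L} \<Longrightarrow> \<phi> s > 0"
    and d1: "\<And>s. s \<in> {m..m+L} \<Longrightarrow> (\<phi> has_real_derivative \<psi> s) (at s)"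
    and d2: "\<And>s. s \<in> {m..m+L} \<Longrightarrow> (\<psi> has_real_derivative \<psi>' s) (at s)"
    and slope: "\<And>s. s \<in> {m..m+L} \<Longrightarrow> \<bar>\<psi> s\<bar> \<le> 1"
    and ode: "\<And>s. s \<in> {m..m+L} \<Longrightarrow> \<psi>' s \<le> \<rho> s - (1 - (\<psi> s)\<^sup>2) / \<phi> s"
    and \<rho>: "continuous_on {m..m+L} \<rho>" "\<And>s. s \<in> {m..m+L} \<Longrightarrow> \<rho> s \<ge> 0"
      "integral {m..m+L} \<rho> \<le> \<eta>"
    and start: "\<psi> m \<le> 0"
  shows "L \<le> 7 * \<phi> m"
proof -
  define R where "R s = integral {m..s} \<rho>" for s
  have R_deriv: "(R has_real_derivative \<rho> s) (at s)" if "m < s" "s < m + L" for s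
  proof -
    have "(R has_real_derivative \<rho> s) (at s within {m..m+L})"
      unfolding R_def by (rule integral_has_real_derivative) (use \<rho> that in auto)
    then show ?thesis using that at_within_interior[of s "{m..m+L}"] by simp
  qed
  have \<rho>_int: "\<rho> integrable_on {m..m+L}" by (rule integrable_continuous_real[OF \<rho>(1)])
  have R_cont: "continuous_on {m..m+L} R"
    unfolding R_def by (rule indefinite_integral_continuous_1[OF \<rho>_int])
  have R_mono: "R s \<le> R t" if "m \<le> s" "s \<le> t" "t \<le> m + L" for s t
    unfolding R_def
    by (rule integral_subset_le) (use that \<rho> in \<open>auto intro!: integrable_subinterval_real[OF \<rho>_int]\<close>)
  have R_bounds: "0 \<le> R s" "R s \<le> \<eta>" if "s \<in> {m..m+L}" for s
    using R_mono[of m s] R_mono[of s "m+L"] that L \<rho>(3) by (auto simp: R_def)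
  have \<phi>_cont: "continuous_on {m..m+L} \<phi>" and \<psi>_cont: "continuous_on {m..m+L} \<psi>"
    using d1 d2 by (meson DERIV_isCont continuous_at_imp_continuous_on)+
  have quad: "1 - (\<psi> s)\<^sup>2 \<ge> 0" if "s \<in> {m..m+L}" for s
    using slope[OF that] by (simp add: abs_square_le_1)
  \<comment> \<open>Subtracting the accumulated error \<open>R\<close> turns the differential inequality into monotonicity.\<close>
  have decrease: "\<psi> t - R t - (\<psi> s - R s) \<le> - c * (t - s)"
    if st: "m \<le> s" "s \<le> t" "t \<le> m + L" and c: "\<And>u. s < u \<Longrightarrow> u < t \<Longrightarrow> c \<le> (1 - (\<psi> u)\<^sup>2) / \<phi> u"
    for s t c
  proof -
    have "\<psi> t - R t + c * t \<le> \<psi> s - R s + c * s"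
    proof (rule DERIV_nonpos_imp_decreasing_open[OF st(2)])
      fix u assume u: "s < u" "u < t"
      have "((\<lambda>u. \<psi> u - R u + c * u) has_real_derivative (\<psi>' u - \<rho> u + c)) (at u)"
        using u st by (auto intro!: derivative_eq_intros d2 R_deriv)
      moreover have "\<psi>' u - \<rho> u + c \<le> 0" using ode[of u] c[OF u] u st by auto
      ultimately show "\<exists>y. ((\<lambda>u. \<psi> u - R u + c * u) has_real_derivative y) (at u) \<and> y \<le> 0"
        by blast
    next
      have "{s..t} \<subseteq> {m..m+L}" using st by auto
      then show "continuous_on {s..t} (\<lambda>u. \<psi> u - R u + c * u)"
        by (intro continuous_intros continuous_on_subset[OF \<psi>_cont] continuous_on_subset[OF R_cont])
    qed
    then show ?thesis by (simp add: algebra_simps)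
  qed
  have drift: "\<psi> t \<le> \<psi> s + \<eta>" if st: "m \<le> s" "s \<le> t" "t \<le> m + L" for s t
  proof -
    have "\<psi> t - R t - (\<psi> s - R s) \<le> - 0 * (t - s)"
      by (rule decrease[OF st]) (use st quad pos in \<open>auto intro!: divide_nonneg_pos\<close>)
    then show ?thesis using R_bounds[of s] R_bounds[of t] st by auto
  qed
  have grow: "\<phi> t \<le> \<phi> s + c * (t - s)"
    if st: "m \<le> s" "s \<le> t" "t \<le> m + L" and c: "\<And>u. s < u \<Longrightarrow> u < t \<Longrightarrow> \<psi> u \<le> c" for s t c
  proof -
    have "\<phi> t - c * t \<le> \<phi> s - c * s"
    proof (rule DERIV_nonpos_imp_decreasing_open[OF st(2)])
      fix u assume u: "s < u" "u < t"
      have "((\<lambda>u. \<phi> u - c * u) has_real_derivative (\<psi> u - c)) (at u)"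
        using u st by (auto intro!: derivative_eq_intros d1)
      then show "\<exists>y. ((\<lambda>u. \<phi> u - c * u) has_real_derivative y) (at u) \<and> y \<le> 0"
        using c[OF u] by force
    next
      have "{s..t} \<subseteq> {m..m+L}" using st by auto
      then show "continuous_on {s..t} (\<lambda>u. \<phi> u - c * u)"
        by (intro continuous_intros continuous_on_subset[OF \<phi>_cont])
    qed
    then show ?thesis by (simp add: algebra_simps)
  qed
  define H where "H = \<phi> m + L / 50"
  have H: "H > 0" using pos[of m] L by (simp add: H_def)
  have slope_le: "\<psi> s \<le> 1 / 50" if "s \<in> {m..m+L}" for s
    using drift[of m s] that start \<eta> by auto
  have \<phi>_le: "\<phi> s \<le> H" if "s \<in> {m..m+L}" for s
  proof -
    have "\<phi> s \<le> \<phi> m + 1/50 * (s - m)" by (rule grow) (use that slope_le in auto)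
    moreover have "1 / 50 * (s - m) \<le> L / 50" using that by auto
    ultimately show ?thesis unfolding H_def by linarith
  qed
  have "L \<le> 6 * H"
  proof (rule ccontr)
    assume "\<not> L \<le> 6 * H"
    then have big: "L > 6 * H" by simp
    have "\<exists>s\<in>{m..m + 2 * H}. \<psi> s < - 1 / 2"
    proof (rule ccontr)
      assume "\<not> ?thesis"
      then have ge: "\<psi> s \<ge> - 1 / 2" if "s \<in> {m..m + 2 * H}" for s using that by force
      have "\<psi> (m + 2 * H) - R (m + 2 * H) - (\<psi> m - R m) \<le> - (3 / (4 * H)) * (m + 2 * H - m)"
      proof (rule decrease)
        fix u assume u: "m < u" "u < m + 2 * H"
        then have u': "u \<in> {m..m+L}" using big H by auto
        have "\<bar>\<psi> u\<bar> \<le> 1 / 2" using ge[of u] slope_le[OF u'] u by auto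
        then have "(\<psi> u)\<^sup>2 \<le> (1/2)\<^sup>2" using abs_le_square_iff[of "\<psi> u" "1/2"] by simp
        then have "3 / 4 \<le> 1 - (\<psi> u)\<^sup>2" by (simp add: power2_eq_square)
        then have "(3 / 4) / H \<le> (1 - (\<psi> u)\<^sup>2) / \<phi> u"
          using \<phi>_le[OF u'] pos[OF u'] quad[OF u'] by (intro frac_le) auto
        then show "3 / (4 * H) \<le> (1 - (\<psi> u)\<^sup>2) / \<phi> u" by simp
      qed (use big H in auto)
      then have "\<psi> (m + 2 * H) \<le> R (m + 2 * H) - R m - 3 / 2" using start H by (simp add: field_simps)
      moreover have "R (m + 2 * H) \<le> 1 / 50" "R m \<ge> 0"
        using R_bounds[of "m + 2 * H"] R_bounds[of m] big H \<eta> L by auto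
      ultimately show False using ge[of "m + 2 * H"] H by auto
    qed
    then obtain s where s: "m \<le> s" "s \<le> m + 2 * H" "\<psi> s < - 1 / 2" by auto
    have "\<phi> (m + L) \<le> \<phi> s + (- 1 / 4) * (m + L - s)"
    proof (rule grow)
      fix u assume "s < u" "u < m + L"
      then show "\<psi> u \<le> - 1 / 4" using drift[of s u] s \<eta> by auto
    qed (use s big H in auto)
    then have "\<phi> (m + L) \<le> H - (L - 2 * H) / 4"
      using \<phi>_le[of s] s big H by (auto simp: field_simps)
    moreover have "\<phi> (m + L) > 0" using L by (intro pos) auto
    ultimately show False using big by (simp add: field_simps)
  qed
  then show ?thesis using pos[of m] L by (simp add: H_def)
qed

text \<open>The differential inequality is invariant under time reversal, so whichever direction leads downhill
  from \<open>m\<close> can be used.\<close>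
lemma almost_concave_lower_bound:
  fixes \<phi> \<psi> \<psi>' \<rho> :: "real \<Rightarrow> real"
  assumes L: "L > 0" and \<eta>: "\<eta> \<le> 1 / 50"
    and pos: "\<And>s. s \<in> {m-L..m+L} \<Longrightarrow> \<phi> s > 0"
    and d1: "\<And>s. s \<in> {m-L..m+L} \<Longrightarrow> (\<phi> has_real_derivative \<psi> s) (at s)"
    and d2: "\<And>s. s \<in> {m-L..m+L} \<Longrightarrow> (\<psi> has_real_derivative \<psi>' s) (at s)"
    and slope: "\<And>s. s \<in> {m-L..m+L} \<Longrightarrow> \<bar>\<psi> s\<bar> \<le> 1"
    and ode: "\<And>s. s \<in> {m-L..m+L} \<Longrightarrow> \<psi>' s \<le> \<rho> s - (1 - (\<psi> s)\<^sup>2) / \<phi> s"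
    and \<rho>: "continuous_on {m-L..m+L} \<rho>" "\<And>s. s \<in> {m-L..m+L} \<Longrightarrow> \<rho> s \<ge> 0"
      "integral {m-L..m+L} \<rho> \<le> \<eta>"
  shows "L \<le> 7 * \<phi> m"
proof (cases "\<psi> m \<le> 0")
  case True
  have "integral {m..m+L} \<rho> \<le> integral {m-L..m+L} \<rho>"
    by (rule integral_subset_le)
      (use L \<rho> in \<open>auto intro!: integrable_continuous_real continuous_on_subset[OF \<rho>(1)]\<close>)
  then show ?thesis
    using True L \<rho>(3)
    by (intro almost_concave_lower_bound_right[OF L \<eta>, of m \<phi> \<psi> \<psi>' \<rho>] pos d1 d2 slope ode \<rho>(2)
        continuous_on_subset[OF \<rho>(1)]) auto
next
  case False
  have "integral {m-L..m} \<rho> \<le> integral {m-L..m+L} \<rho>"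
    by (rule integral_subset_le)
      (use L \<rho> in \<open>auto intro!: integrable_continuous_real continuous_on_subset[OF \<rho>(1)]\<close>)
  then have int: "integral {-m..-m+L} (\<lambda>s. \<rho> (- s)) \<le> \<eta>"
    using \<rho>(3) Henstock_Kurzweil_Integration.integral_reflect_real[of "m" "m-L" "\<rho>"]
    by (simp add: add.commute)
  have mem: "- s \<in> {m-L..m+L}" if "s \<in> {-m..-m+L}" for s using that L by auto
  have "L \<le> 7 * (\<lambda>s. \<phi> (- s)) (- m)"
  proof (rule almost_concave_lower_bound_right[OF L \<eta>, of "-m" "\<lambda>s. \<phi> (-s)" "\<lambda>s. - \<psi> (-s)"
        "\<lambda>s. \<psi>' (-s)" "\<lambda>s. \<rho> (-s)"])
    fix s assume s: "s \<in> {-m..-m+L}"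
    show "((\<lambda>s. \<phi> (- s)) has_real_derivative - \<psi> (- s)) (at s)"
      using DERIV_chain'[OF DERIV_minus[OF DERIV_ident] d1[OF mem[OF s]]] by simp
    show "((\<lambda>s. - \<psi> (- s)) has_real_derivative \<psi>' (- s)) (at s)"
      using DERIV_minus[OF DERIV_chain'[OF DERIV_minus[OF DERIV_ident] d2[OF mem[OF s]]]] by simp
  next
    show "continuous_on {- m..- m + L} (\<lambda>s. \<rho> (- s))"
      by (rule continuous_on_compose2[OF \<rho>(1)]) (use mem in \<open>auto intro!: continuous_intros\<close>)
  qed (use mem pos slope ode \<rho>(2) int False in \<open>auto\<close>)
  then show ?thesis by simp
qed

section \<open>Periodic densities and second-order difference quotients\<close>

text \<open>Sliding the left end of a period interval by at most one period moves mass from one end to the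
  other; larger shifts are composed of such steps.\<close>
lemma emeasure_density_periodic:
  fixes h :: "real \<Rightarrow> ennreal"
  assumes h: "h \<in> borel_measurable lborel" and per: "\<And>x. h (x + l) = h x" and l: "l > 0"
  shows "emeasure (density lborel h) {a..<a+l} = emeasure (density lborel h) {b..<b+l}"
proof -
  let ?\<mu> = "density lborel h"
  have shift: "emeasure ?\<mu> {c+l..<d+l} = emeasure ?\<mu> {c..<d}" for c d
  proof -
    have "(\<integral>\<^sup>+x. h x * indicator {c+l..<d+l} x \<partial>lborel)
        = (\<integral>\<^sup>+x. h (l + 1 * x) * indicator {c+l..<d+l} (l + 1 * x) \<partial>lborel)"
      by (subst nn_integral_real_affine[of _ 1 l]) (use h in simp_all)
    also have "\<dots> = (\<integral>\<^sup>+x. h x * indicator {c..<d} x \<partial>lborel)"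
      by (intro nn_integral_cong) (auto simp: per add.commute[of l] split: split_indicator)
    finally show ?thesis using h by (simp add: emeasure_density)
  qed
  have step: "emeasure ?\<mu> {c..<c+l} = emeasure ?\<mu> {d..<d+l}" if "c \<le> d" "d \<le> c + l" for c d
  proof -
    have "emeasure ?\<mu> {c..<d} + emeasure ?\<mu> {d..<c+l} = emeasure ?\<mu> {c..<c+l}"
      by (subst plus_emeasure) (use that in \<open>auto intro!: arg_cong2[where f=emeasure]\<close>)
    moreover have "emeasure ?\<mu> {d..<c+l} + emeasure ?\<mu> {c+l..<d+l} = emeasure ?\<mu> {d..<d+l}"
      by (subst plus_emeasure) (use that in \<open>auto intro!: arg_cong2[where f=emeasure]\<close>)
    ultimately show ?thesis using shift[of c d] by (simp add: add.commute)
  qed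
  have steps: "emeasure ?\<mu> {c..<c+l} = emeasure ?\<mu> {c + real n * e..<c + real n * e + l}"
    if "0 \<le> e" "e \<le> l" for c e n
  proof (induction n)
    case (Suc n)
    have "emeasure ?\<mu> {c + real n * e..<c + real n * e + l}
      = emeasure ?\<mu> {c + real (Suc n) * e..<c + real (Suc n) * e + l}"
      by (rule step) (use that in \<open>auto simp: algebra_simps\<close>)
    then show ?case using Suc by simp
  qed simp
  have mono: "emeasure ?\<mu> {c..<c+l} = emeasure ?\<mu> {d..<d+l}" if "c \<le> d" for c d
  proof -
    obtain n :: nat where n: "(d - c) / l < n" using reals_Archimedean2 by blast
    then have n0: "n > 0" using that l by (cases n) (auto simp: field_simps)
    have "emeasure ?\<mu> {c..<c+l} = emeasure ?\<mu> {c + real n * ((d-c)/n)..<c + real n * ((d-c)/n) + l}"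
      by (rule steps) (use that n n0 l in \<open>auto simp: field_simps\<close>)
    then show ?thesis using n0 by simp
  qed
  show ?thesis using mono[of a b] mono[of b a] by (metis linear)
qed

text \<open>Taylor's theorem of order two in Peano's form: only the derivative at \<open>s\<close> of \<open>v\<close> is available, so the
  mean value inequality is applied to the difference \<open>G\<close> of \<open>f\<close> and its Taylor polynomial.\<close>
lemma second_order_quotient_tendsto:
  fixes f :: "real \<Rightarrow> 'a::real_normed_vector"
  assumes f: "\<And>t. (f has_vector_derivative v t) (at t)"
    and v: "(v has_vector_derivative k) (at s)"
  shows "((\<lambda>t. (f t - f s - (t - s) *\<^sub>R v s) /\<^sub>R (t - s)\<^sup>2) \<longlongrightarrow> k /\<^sub>R 2) (at s)"
proof (rule tendstoI)
  fix e :: real assume e: "e > 0"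
  define G where "G t = f t - (t - s) *\<^sub>R v s - ((t - s)\<^sup>2 / 2) *\<^sub>R k" for t
  from v have "(v has_derivative (\<lambda>h. h *\<^sub>R k)) (at s)"
    by (simp add: has_vector_derivative_def)
  then obtain d where d: "d > 0"
    and dv: "\<And>u. norm (u - s) < d \<Longrightarrow> norm (v u - v s - (u - s) *\<^sub>R k) \<le> e / 2 * norm (u - s)"
    using e unfolding has_derivative_at_alt by (meson half_gt_zero)
  have "dist ((f t - f s - (t - s) *\<^sub>R v s) /\<^sub>R (t - s)\<^sup>2) (k /\<^sub>R 2) < e"
    if t: "t \<noteq> s" "dist t s < d" for t
  proof -
    have G: "(G has_vector_derivative v u - v s - (u - s) *\<^sub>R k) (at u within S)" for u S
      unfolding G_def
      by (auto intro!: derivative_eq_intros has_vector_derivative_at_within[OF f] simp: power2_eq_square)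
    have "norm (G t - G s) \<le> (e / 2 * norm (t - s)) * norm (t - s)"
    proof (rule differentiable_bound[where S = "closed_segment s t"])
      fix u assume u: "u \<in> closed_segment s t"
      show "(G has_derivative (\<lambda>h. h *\<^sub>R (v u - v s - (u - s) *\<^sub>R k))) (at u within closed_segment s t)"
        using G by (simp add: has_vector_derivative_def)
      have us: "norm (u - s) \<le> norm (t - s)"
        using u by (auto simp: closed_segment_eq_real_ivl split: if_splits)
      have "norm (v u - v s - (u - s) *\<^sub>R k) \<le> e / 2 * norm (u - s)"
        by (rule dv) (use us t in \<open>simp add: dist_norm\<close>)
      also have "\<dots> \<le> e / 2 * norm (t - s)" using us e by (intro mult_left_mono) auto
      finally show "onorm (\<lambda>h. h *\<^sub>R (v u - v s - (u - s) *\<^sub>R k)) \<le> e / 2 * norm (t - s)"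
        by (simp add: onorm_scaleR_left onorm_id bounded_linear_ident)
    qed auto
    moreover have "G t - G s = (t - s)\<^sup>2 *\<^sub>R ((f t - f s - (t - s) *\<^sub>R v s) /\<^sub>R (t - s)\<^sup>2 - k /\<^sub>R 2)"
      using t by (simp add: G_def scaleR_diff_right field_simps)
    ultimately have "(t - s)\<^sup>2 * norm ((f t - f s - (t - s) *\<^sub>R v s) /\<^sub>R (t - s)\<^sup>2 - k /\<^sub>R 2)
        \<le> (t - s)\<^sup>2 * (e / 2)"
      by (simp add: power2_eq_square abs_mult_self_eq mult.commute mult.left_commute)
    then have "norm ((f t - f s - (t - s) *\<^sub>R v s) /\<^sub>R (t - s)\<^sup>2 - k /\<^sub>R 2) \<le> e / 2"
      using t by simp
    then show ?thesis using e by (simp add: dist_norm)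
  qed
  then show "\<forall>\<^sub>F t in at s. dist ((f t - f s - (t - s) *\<^sub>R v s) /\<^sub>R (t - s)\<^sup>2) (k /\<^sub>R 2) < e"
    using d unfolding eventually_at by blast
qed

section \<open>Reflections, inversions, and three curves in a tube\<close>

lemma norm_reflection:
  fixes d x :: "'a::real_inner"
  shows "norm ((2 * (d \<bullet> x) / (d \<bullet> d)) *\<^sub>R d - x) = norm x"
proof -
  define c where "c = 2 * (d \<bullet> x) / (d \<bullet> d)"
  have "c * (d \<bullet> d) = 2 * (d \<bullet> x)" by (simp add: c_def)
  then have "(c *\<^sub>R d - x) \<bullet> (c *\<^sub>R d - x) = x \<bullet> x"
    by (simp add: inner_simps inner_commute[of x d] algebra_simps)
  then show ?thesis by (simp add: norm_eq_sqrt_inner c_def)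
qed

lemma dist_inversion:
  fixes a b :: "'a::real_inner"
  assumes "a \<noteq> 0" "b \<noteq> 0"
  shows "norm (a /\<^sub>R (norm a)\<^sup>2 - b /\<^sub>R (norm b)\<^sup>2) = norm (a - b) / (norm a * norm b)"
proof -
  define \<alpha> \<beta> where "\<alpha> = norm a" and "\<beta> = norm b"
  have n: "\<alpha> > 0" "\<beta> > 0" using assms by (auto simp: \<alpha>_def \<beta>_def)
  have sq: "a \<bullet> a = \<alpha>\<^sup>2" "b \<bullet> b = \<beta>\<^sup>2" by (simp_all add: \<alpha>_def \<beta>_def power2_norm_eq_inner)
  have "(norm (a /\<^sub>R \<alpha>\<^sup>2 - b /\<^sub>R \<beta>\<^sup>2))\<^sup>2 = (\<alpha>\<^sup>2 + \<beta>\<^sup>2 - 2 * (a \<bullet> b)) / (\<alpha>\<^sup>2 * \<beta>\<^sup>2)"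
    unfolding power2_norm_eq_inner using n
    by (simp add: inner_diff_left inner_diff_right inner_commute[of b a] sq power2_eq_square field_simps)
  also have "\<alpha>\<^sup>2 + \<beta>\<^sup>2 - 2 * (a \<bullet> b) = (norm (a - b))\<^sup>2"
    unfolding power2_norm_eq_inner
    by (simp add: inner_diff_left inner_diff_right inner_commute[of b a] sq)
  also have "(norm (a - b))\<^sup>2 / (\<alpha>\<^sup>2 * \<beta>\<^sup>2) = (norm (a - b) / (\<alpha> * \<beta>))\<^sup>2"
    by (simp add: power_divide power_mult_distrib)
  finally have "norm (a /\<^sub>R \<alpha>\<^sup>2 - b /\<^sub>R \<beta>\<^sup>2) = norm (a - b) / (\<alpha> * \<beta>)"
    using n by (simp add: power2_eq_iff_nonneg)
  then show ?thesis by (simp add: \<alpha>_def \<beta>_def)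
qed

text \<open>
  Three curves start within \<open>2 r\<close> of \<open>x\<close>, move a distance of at least \<open>27 r\<close> away from \<open>x\<close>, and
  separate linearly from each other. Inverted at a distant point \<open>p\<close>, they lie in a tube of radius \<open>\<tau>\<close>
  with axis direction \<open>u\<close>. In the coordinate \<open>z\<close> along the tube they start within \<open>8 r / D\<^sup>2\<close> of the
  inverted point \<open>x\<close> and end beyond \<open>9 r / D\<^sup>2\<close> in absolute value, because inversion scales lengths near \<open>x\<close>
  by about \<open>1 / D\<^sup>2\<close>. Two of the three curves leave to the same side and so both attain the level
  \<open>9 r / D\<^sup>2\<close>, at points within \<open>2 \<tau>\<close> of each other; these are too close before inversion.
\<close>
lemma three_strands_in_tube_False:
  fixes P :: "nat \<Rightarrow> real \<Rightarrow> 'a::real_inner" and p x u :: 'a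
  defines "inver \<equiv> \<lambda>q. (q - p) /\<^sub>R (norm (q - p))\<^sup>2"
  defines "D \<equiv> norm (x - p)"
  assumes r: "r > 0" and D: "D \<ge> 300 * r" and u: "norm u = 1"
    and \<tau>: "28 * (\<tau> * D\<^sup>2) < r"
    and cont: "\<And>i. i < 3 \<Longrightarrow> continuous_on {r..200*r} (P i)"
    and near: "\<And>i \<rho>. i < 3 \<Longrightarrow> \<rho> \<in> {r..200*r} \<Longrightarrow> norm (P i \<rho> - x) \<le> \<rho> + r"
    and far: "\<And>i. i < 3 \<Longrightarrow> norm (P i (200*r) - x) \<ge> 27 * r"
    and apart: "\<And>i j \<rho> \<rho>'. i < 3 \<Longrightarrow> j < 3 \<Longrightarrow> i \<noteq> j \<Longrightarrow> \<rho> \<in> {r..200*r} \<Longrightarrow> \<rho>' \<in> {r..200*r} \<Longrightarrow>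
        \<rho> - r \<le> 7 * norm (P i \<rho> - P j \<rho>')"
    and tube: "\<And>i \<rho>. i < 3 \<Longrightarrow> \<rho> \<in> {r..200*r} \<Longrightarrow>
        norm ((inver (P i \<rho>) - inver x) - ((inver (P i \<rho>) - inver x) \<bullet> u) *\<^sub>R u) \<le> \<tau>"
  shows False
proof -
  define z where "z i \<rho> = (inver (P i \<rho>) - inver x) \<bullet> u" for i \<rho>
  have D0: "D > 0" using D r by linarith
  have dist_lower: "norm (P i \<rho> - p) \<ge> D - (\<rho> + r)" and dist_upper: "norm (P i \<rho> - p) \<le> 2 * D"
    if "i < 3" "\<rho> \<in> {r..200*r}" for i \<rho>
  proof -
    have "D \<le> norm (P i \<rho> - x) + norm (P i \<rho> - p)"
      using norm_triangle_ineq4[of "P i \<rho> - p" "P i \<rho> - x"] by (simp add: D_def)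
    then show "norm (P i \<rho> - p) \<ge> D - (\<rho> + r)" using near[OF that] by linarith
    have "norm (P i \<rho> - p) \<le> norm (P i \<rho> - x) + D"
      using norm_triangle_ineq[of "P i \<rho> - x" "x - p"] by (simp add: D_def)
    then show "norm (P i \<rho> - p) \<le> 2 * D" using near[OF that] D r that(2) by auto
  qed
  have dist_pos: "norm (P i \<rho> - p) > 0" if "i < 3" "\<rho> \<in> {r..200*r}" for i \<rho>
    using dist_lower[OF that] D r that(2) by auto
  have inv_dist: "norm (inver (P i \<rho>) - inver x) = norm (P i \<rho> - x) / (norm (P i \<rho> - p) * D)"
    if "i < 3" "\<rho> \<in> {r..200*r}" for i \<rho>
    using dist_inversion[of "P i \<rho> - p" "x - p"] dist_pos[OF that] D0
    by (auto simp: inver_def D_def)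
  \<comment> \<open>Up to \<open>3 r\<close>, and not only at \<open>r\<close>: the level below is then attained later than \<open>3 r\<close>, where
    \<open>apart\<close> gives a definite separation.\<close>
  have start: "\<bar>z i \<rho>\<bar> \<le> 8 * r / D\<^sup>2" if "i < 3" "\<rho> \<in> {r..3*r}" for i \<rho>
  proof -
    have \<rho>: "\<rho> \<in> {r..200*r}" using that r by auto
    have "\<bar>z i \<rho>\<bar> \<le> norm (inver (P i \<rho>) - inver x)"
      using Cauchy_Schwarz_ineq2[of "inver (P i \<rho>) - inver x" u] u by (simp add: z_def)
    also have "\<dots> \<le> (4 * r) / (D / 2 * D)"
      unfolding inv_dist[OF that(1) \<rho>]
      using near[OF that(1) \<rho>] dist_lower[OF that(1) \<rho>] that(2) D D0 r
      by (intro frac_le mult_right_mono) auto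
    finally show ?thesis by (simp add: power2_eq_square)
  qed
  have \<tau>_le: "\<tau> \<le> r / D\<^sup>2"
  proof -
    have "\<tau> * D\<^sup>2 \<le> r" using \<tau> r by linarith
    then show ?thesis using D0 by (simp add: field_simps)
  qed
  have finish: "\<bar>z i (200*r)\<bar> \<ge> 9 * r / D\<^sup>2" if "i < 3" for i
  proof -
    have \<rho>: "200 * r \<in> {r..200*r}" using r by auto
    have "27 * r / (2 * D * D) \<le> norm (inver (P i (200*r)) - inver x)"
      unfolding inv_dist[OF that \<rho>]
      using far[OF that] dist_upper[OF that \<rho>] dist_pos[OF that \<rho>] D0 r
      by (intro frac_le mult_right_mono) auto
    also have "\<dots> \<le> \<tau> + \<bar>z i (200*r)\<bar>"
      using norm_triangle_sub[of "inver (P i (200*r)) - inver x" "z i (200*r) *\<^sub>R u"] tube[OF that \<rho>] u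
      by (simp add: z_def)
    finally have "27 * r / (2 * D * D) \<le> r / D\<^sup>2 + \<bar>z i (200*r)\<bar>" using \<tau>_le by linarith
    moreover have "27 * r / (2 * D * D) = (27 / 2) * (r / D\<^sup>2)" by (simp add: power2_eq_square)
    moreover have "r / D\<^sup>2 \<ge> 0" using r by simp
    ultimately show ?thesis by simp
  qed
  have "\<exists>i<3. \<exists>j<3. i \<noteq> j \<and> (z i (200*r) \<ge> 0 \<longleftrightarrow> z j (200*r) \<ge> 0)"
  proof -
    have "(0::nat) < 3" "(1::nat) < 3" "(2::nat) < 3" "(0::nat) \<noteq> 1" "(1::nat) \<noteq> 2" "(0::nat) \<noteq> 2" by auto
    then show ?thesis by metis
  qed
  then obtain i j where ij: "i < 3" "j < 3" "i \<noteq> j" "z i (200*r) \<ge> 0 \<longleftrightarrow> z j (200*r) \<ge> 0" by blast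
  define \<sigma> :: real where "\<sigma> = (if z i (200*r) \<ge> 0 then 1 else - 1)"
  have \<sigma>: "\<bar>\<sigma>\<bar> = 1" by (simp add: \<sigma>_def)
  have level: "\<exists>\<rho>\<in>{3*r..200*r}. \<sigma> * z h \<rho> = 9 * r / D\<^sup>2" if h: "h = i \<or> h = j" for h
  proof -
    have h3: "h < 3" using h ij by auto
    have r2: "r / D\<^sup>2 > 0" using r D0 by simp
    have "continuous_on {3*r..200*r} (\<lambda>\<rho>. \<sigma> * z h \<rho>)"
      unfolding z_def inver_def
      by (intro continuous_intros continuous_on_subset[OF cont[OF h3]])
        (use dist_pos[OF h3] r in force)+
    moreover have "\<sigma> * z h (3*r) \<le> 9 * r / D\<^sup>2"
    proof -
      have "\<sigma> * z h (3*r) \<le> \<bar>z h (3*r)\<bar>" using \<sigma> by (auto simp: \<sigma>_def)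
      then show ?thesis using start[OF h3, of "3*r"] r r2 by auto
    qed
    moreover have "\<sigma> * z h (200*r) \<ge> 9 * r / D\<^sup>2"
      using finish[OF h3] h ij(4) by (auto simp: \<sigma>_def split: if_splits)
    ultimately show ?thesis
      using IVT'[of "\<lambda>\<rho>. \<sigma> * z h \<rho>" "3*r" "9 * r / D\<^sup>2" "200*r"] r by auto
  qed
  obtain \<rho> \<rho>' where \<rho>: "\<rho> \<in> {3*r..200*r}" "\<sigma> * z i \<rho> = 9 * r / D\<^sup>2"
    and \<rho>': "\<rho>' \<in> {3*r..200*r}" "\<sigma> * z j \<rho>' = 9 * r / D\<^sup>2" using level[of i] level[of j] by blast
  have mem: "\<rho> \<in> {r..200*r}" "\<rho>' \<in> {r..200*r}" using \<rho> \<rho>' r by auto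
  have "z i \<rho> = z j \<rho>'" using \<rho>(2) \<rho>'(2) \<sigma> by (metis abs_zero mult_left_cancel zero_neq_one)
  then have "inver (P i \<rho>) - inver (P j \<rho>') =
      ((inver (P i \<rho>) - inver x) - z i \<rho> *\<^sub>R u) - ((inver (P j \<rho>') - inver x) - z j \<rho>' *\<^sub>R u)"
    by simp
  also have "norm \<dots> \<le> norm ((inver (P i \<rho>) - inver x) - z i \<rho> *\<^sub>R u)
      + norm ((inver (P j \<rho>') - inver x) - z j \<rho>' *\<^sub>R u)"
    by (rule norm_triangle_ineq4)
  also have "\<dots> \<le> \<tau> + \<tau>"
    using tube[OF ij(1) mem(1)] tube[OF ij(2) mem(2)] unfolding z_def by (rule add_mono)
  finally have "norm (inver (P i \<rho>) - inver (P j \<rho>')) \<le> \<tau> + \<tau>" .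
  moreover have "norm (inver (P i \<rho>) - inver (P j \<rho>'))
      = norm (P i \<rho> - P j \<rho>') / (norm (P i \<rho> - p) * norm (P j \<rho>' - p))"
    using dist_inversion[of "P i \<rho> - p" "P j \<rho>' - p"] dist_pos[OF ij(1) mem(1)] dist_pos[OF ij(2) mem(2)]
    by (simp add: inver_def)
  ultimately have "norm (P i \<rho> - P j \<rho>') \<le> (\<tau> + \<tau>) * (norm (P i \<rho> - p) * norm (P j \<rho>' - p))"
    using dist_pos[OF ij(1) mem(1)] dist_pos[OF ij(2) mem(2)] by (simp add: divide_le_eq)
  also have "\<dots> \<le> (\<tau> + \<tau>) * ((2 * D) * (2 * D))"
  proof -
    have "\<tau> \<ge> 0" using tube[OF ij(1) mem(1)] norm_ge_zero order_trans by blast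
    then show ?thesis
      using dist_upper[OF ij(1) mem(1)] dist_upper[OF ij(2) mem(2)] D0
      by (intro mult_left_mono mult_mono) auto
  qed
  finally have "7 * norm (P i \<rho> - P j \<rho>') \<le> 56 * (\<tau> * D\<^sup>2)" by (simp add: power2_eq_square mult_ac)
  then show False using apart[OF ij(1-3) mem] \<tau> \<rho>(1) by auto
qed

section \<open>Arc-length parametrized knots\<close>

text \<open>Here \<open>v\<close> is the unit tangent and \<open>k\<close> the curvature vector; the parameter line is the universal cover
  of the knot, so that arcs may run across the base point.\<close>
locale unit_speed_knot =
  fixes l :: real and f v k :: "real \<Rightarrow> real ^ 3"
  assumes l_pos: "l > 0"
    and f_deriv: "\<And>s. (f has_vector_derivative v s) (at s)"
    and v_deriv: "\<And>s. (v has_vector_derivative k s) (at s)"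
    and k_cont: "continuous_on UNIV k"
    and norm_v [simp]: "\<And>s. norm (v s) = 1"
    and f_periodic: "\<And>s. f (s + l) = f s"
    and f_inj: "inj_on f {0..<l}"
begin

lemma v_inner_v [simp]: "v s \<bullet> v s = 1"
  using norm_v[of s] by (simp only: norm_eq_1)

lemma f_cont: "continuous_on S f"
  using f_deriv by (meson continuous_at_imp_continuous_on has_vector_derivative_continuous)

lemma v_cont: "continuous_on S v"
  using v_deriv by (meson continuous_at_imp_continuous_on has_vector_derivative_continuous)

lemma f_measurable [measurable]: "f \<in> borel_measurable borel"
  by (rule borel_measurable_continuous_onI[OF f_cont])

lemma v_measurable [measurable]: "v \<in> borel_measurable borel"
  by (rule borel_measurable_continuous_onI[OF v_cont])

lemma v_periodic: "v (s + l) = v s"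
proof -
  have "((f \<circ> (\<lambda>s. s + l)) has_vector_derivative (1 *\<^sub>R v (s + l))) (at s)"
    by (rule vector_diff_chain_at) (auto intro!: derivative_eq_intros f_deriv)
  moreover have "f \<circ> (\<lambda>s. s + l) = f" using f_periodic by auto
  ultimately show ?thesis using f_deriv[of s] by (simp add: vector_derivative_unique_at)
qed

lemma f_periodic_int: "f (s + of_int n * l) = f s"
proof -
  have nat: "f (s + real n * l) = f s" for n s
  proof (induction n)
    case (Suc n)
    then show ?case using f_periodic[of "s + real n * l"] by (simp add: algebra_simps)
  qed simp
  show ?thesis
  proof (cases "n \<ge> 0")
    case True
    then show ?thesis using nat[of s "nat n"] by simp
  next
    case False
    then show ?thesis using nat[of "s + of_int n * l" "nat (-n)"] by simp
  qed
qed

lemma f_neq: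
  assumes "s \<noteq> t" "\<bar>s - t\<bar> < l"
  shows "f s \<noteq> f t"
proof
  assume eq: "f s = f t"
  define m n where "m = \<lfloor>s / l\<rfloor>" and "n = \<lfloor>t / l\<rfloor>"
  have mem: "s + of_int (-m) * l \<in> {0..<l}" "t + of_int (-n) * l \<in> {0..<l}"
    using floor_divide_lower[OF l_pos, of s] floor_divide_upper[OF l_pos, of s]
      floor_divide_lower[OF l_pos, of t] floor_divide_upper[OF l_pos, of t]
    by (auto simp: m_def n_def algebra_simps)
  have "f (s + of_int (-m) * l) = f (t + of_int (-n) * l)"
    by (simp only: f_periodic_int eq)
  then have "s + of_int (-m) * l = t + of_int (-n) * l" using inj_onD[OF f_inj] mem by blast
  then have st: "s - t = of_int (m - n) * l" by (simp add: algebra_simps)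
  then have "\<bar>of_int (m - n) :: real\<bar> * l < 1 * l" using assms l_pos by (simp add: abs_mult)
  then have "\<bar>of_int (m - n) :: real\<bar> < 1" using l_pos by simp
  then have "m = n" by linarith
  then show False using st assms by simp
qed

lemma v_inner_k [simp]: "v s \<bullet> k s = 0"
proof -
  have "((\<lambda>s. v s \<bullet> v s) has_vector_derivative (v s \<bullet> k s + k s \<bullet> v s)) (at s)"
    by (rule bounded_bilinear.has_vector_derivative[OF bounded_bilinear_inner v_deriv v_deriv])
  then have "((\<lambda>s. 1) has_vector_derivative (2 * (v s \<bullet> k s))) (at s)"
    by (simp add: inner_commute)
  then have "2 * (v s \<bullet> k s) = 0"
    using vector_derivative_unique_at has_vector_derivative_const by blast
  then show ?thesis by simp
qed

lemma f_lipschitz: "norm (f s - f t) \<le> \<bar>s - t\<bar>"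
proof -
  have "norm (f s - f t) \<le> 1 * norm (s - t)"
    by (rule differentiable_bound[of UNIV f "\<lambda>u h. h *\<^sub>R v u"])
      (auto simp: f_deriv[unfolded has_vector_derivative_def] onorm_scaleR_left bounded_linear_ident onorm_id)
  then show ?thesis by simp
qed

subsection \<open>The energy density as the speed of an inverted knot\<close>

definition normal_part :: "real \<Rightarrow> real ^ 3 \<Rightarrow> real ^ 3" where
  "normal_part s x = x - (x \<bullet> v s) *\<^sub>R v s"

definition inverted :: "real \<Rightarrow> real \<Rightarrow> real ^ 3" where
  "inverted s t = (f t - f s) /\<^sub>R (norm (f t - f s))\<^sup>2"

text \<open>The circle tangent to the knot at \<open>f s\<close> and passing through \<open>f t\<close> has curvature vector
  \<open>2 * half_curvature s t\<close> at \<open>f s\<close>.\<close>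
definition half_curvature :: "real \<Rightarrow> real \<Rightarrow> real ^ 3" where
  "half_curvature s t = normal_part s (inverted s t)"

text \<open>The integrand \<open>|sin \<theta>| / |f s - f t|\<^sup>2\<close>: the number \<open>c\<close> is \<open>cos \<theta>\<close>, as computed in
  \<open>conformal_angle_eq\<close>. On the diagonal it vanishes by division by zero.\<close>
definition energy_density :: "real \<Rightarrow> real \<Rightarrow> real" where
  "energy_density s t =
    (let d = f s - f t; c = v s \<bullet> ((2 * (d \<bullet> v t) / (d \<bullet> d)) *\<^sub>R d - v t)
     in sqrt (1 - c\<^sup>2) / (norm d)\<^sup>2)"

definition point_energy :: "real \<Rightarrow> ennreal" where
  "point_energy s = emeasure (density lborel (\<lambda>t. ennreal (energy_density s t))) {0..<l}"

definition energy_measure :: "real measure" where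
  "energy_measure = density lborel point_energy"

lemma bounded_linear_normal_part: "bounded_linear (normal_part s)"
  unfolding normal_part_def
  by (intro bounded_linear_sub bounded_linear_ident bounded_linear_compose[OF bounded_linear_scaleR_left]
      bounded_linear_inner_left)

lemma norm_normal_part: "(norm (normal_part s x))\<^sup>2 = (norm x)\<^sup>2 - (x \<bullet> v s)\<^sup>2"
  unfolding normal_part_def power2_norm_eq_inner
  by (simp add: inner_simps inner_commute power2_eq_square)

lemma energy_density_measurable [measurable]:
  "(\<lambda>(s, t). energy_density s t) \<in> borel_measurable (borel \<Otimes>\<^sub>M borel)"
  unfolding energy_density_def Let_def by measurable

lemma energy_density_measurable_right [measurable]: "energy_density s \<in> borel_measurable borel"
  unfolding energy_density_def Let_def by measurable

lemma point_energy_measurable [measurable]: "point_energy \<in> borel_measurable borel"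
proof -
  have "(\<lambda>s. \<integral>\<^sup>+t. ennreal (energy_density s t) * indicator {0..<l} t \<partial>lborel) \<in> borel_measurable borel"
    by (rule lborel.borel_measurable_nn_integral) measurable
  then show ?thesis
    by (simp add: point_energy_def[abs_def] emeasure_density)
qed

lemma sets_energy_measure [simp]: "sets energy_measure = sets borel"
  by (simp add: energy_measure_def)

lemma energy_density_periodic:
  "energy_density s (t + l) = energy_density s t" "energy_density (s + l) t = energy_density s t"
  by (simp_all add: energy_density_def f_periodic v_periodic)

lemma point_energy_periodic: "point_energy (s + l) = point_energy s"
  by (simp add: point_energy_def energy_density_periodic)

lemma energy_measure_period: "energy_measure {a..<a+l} = energy_measure {b..<b+l}"
  unfolding energy_measure_def
  by (rule emeasure_density_periodic) (use point_energy_periodic l_pos in auto)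

lemma inverted_deriv:
  assumes "f s \<noteq> f t"
  defines "d \<equiv> f s - f t"
  shows "(inverted s has_vector_derivative
     (- 1 / (norm d)\<^sup>2) *\<^sub>R ((2 * (d \<bullet> v t) / (d \<bullet> d)) *\<^sub>R d - v t)) (at t)"
proof -
  define g where "g u = f u - f s" for u
  have d: "d = - g t" by (simp add: d_def g_def)
  have g0: "g t \<bullet> g t > 0" using assms by (simp add: g_def)
  have g: "(g has_vector_derivative v t) (at t)"
    unfolding g_def by (auto intro!: derivative_eq_intros f_deriv)
  have "((\<lambda>t. g t \<bullet> g t) has_vector_derivative (g t \<bullet> v t + v t \<bullet> g t)) (at t)"
    by (rule bounded_bilinear.has_vector_derivative[OF bounded_bilinear_inner g g])
  then have "((\<lambda>t. g t \<bullet> g t) has_real_derivative (2 * (g t \<bullet> v t))) (at t)"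
    by (simp add: inner_commute has_real_derivative_iff_has_vector_derivative)
  from DERIV_inverse_fun[OF this] g0
  have "((\<lambda>t. inverse (g t \<bullet> g t)) has_real_derivative
      (- (2 * (g t \<bullet> v t)) / (g t \<bullet> g t)\<^sup>2)) (at t)"
    by (simp add: power2_eq_square field_simps)
  from has_vector_derivative_scaleR[OF this g]
  have "((\<lambda>t. inverse (g t \<bullet> g t) *\<^sub>R g t) has_vector_derivative
      (inverse (g t \<bullet> g t) *\<^sub>R v t + (- (2 * (g t \<bullet> v t)) / (g t \<bullet> g t)\<^sup>2) *\<^sub>R g t)) (at t)"
    by simp
  moreover have "inverse (g t \<bullet> g t) *\<^sub>R v t + (- (2 * (g t \<bullet> v t)) / (g t \<bullet> g t)\<^sup>2) *\<^sub>R g t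
     = (- 1 / (norm d)\<^sup>2) *\<^sub>R ((2 * (d \<bullet> v t) / (d \<bullet> d)) *\<^sub>R d - v t)"
  proof -
    have "(norm d)\<^sup>2 = g t \<bullet> g t" by (simp add: d power2_norm_eq_inner)
    then show ?thesis using g0 by (simp add: d scaleR_diff_right power2_eq_square field_simps)
  qed
  ultimately show ?thesis
    unfolding inverted_def[abs_def] power2_norm_eq_inner g_def by simp
qed

text \<open>The velocity of the inverted knot is \<open>- 1 / |f s - f t|\<^sup>2\<close> times the unit tangent at \<open>f s\<close> of the circle
  \<open>C(t, t, s)\<close>; its part normal to the knot at \<open>f s\<close> therefore has the length \<open>|sin \<theta>| / |f s - f t|\<^sup>2\<close>.\<close>
lemma half_curvature_deriv:
  assumes "f s \<noteq> f t"
  obtains y where "(half_curvature s has_vector_derivative y) (at t)" "norm y = energy_density s t"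
proof -
  define d where "d = f s - f t"
  define w where "w = (2 * (d \<bullet> v t) / (d \<bullet> d)) *\<^sub>R d - v t"
  have nw: "norm w = 1" by (simp add: w_def norm_reflection)
  have "(half_curvature s has_vector_derivative normal_part s ((- 1 / (norm d)\<^sup>2) *\<^sub>R w)) (at t)"
    unfolding half_curvature_def[abs_def]
    by (rule bounded_linear.has_vector_derivative[OF bounded_linear_normal_part])
      (use inverted_deriv[OF assms] in \<open>simp add: d_def w_def\<close>)
  moreover have "norm (normal_part s ((- 1 / (norm d)\<^sup>2) *\<^sub>R w)) = energy_density s t"
  proof -
    have "norm (normal_part s w) = sqrt (1 - (v s \<bullet> w)\<^sup>2)"
      using norm_normal_part[of s w] nw by (metis inner_commute norm_ge_zero power_one real_sqrt_unique)
    then show ?thesis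
      by (simp add: linear_simps[OF bounded_linear_normal_part] energy_density_def Let_def w_def d_def)
  qed
  ultimately show ?thesis using that by blast
qed

lemma energy_density_nonneg: "energy_density s t \<ge> 0"
proof (cases "f s = f t")
  case False
  then show ?thesis by (metis half_curvature_deriv norm_ge_zero)
qed (simp add: energy_density_def)

lemma energy_density_cont:
  assumes "\<And>t. t \<in> S \<Longrightarrow> f s \<noteq> f t"
  shows "continuous_on S (energy_density s)"
  unfolding energy_density_def[abs_def] Let_def
  by (intro continuous_intros f_cont v_cont) (use assms in auto)

lemma half_curvature_periodic: "half_curvature s (t + l) = half_curvature s t"
  by (simp add: half_curvature_def inverted_def f_periodic)

text \<open>A curve is at least as long as the distance of its ends. The path from \<open>t1\<close> to \<open>t2\<close> must avoid
  \<open>s\<close>, where the inverted knot is at infinity.\<close>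
lemma half_curvature_variation_ordered:
  assumes "s < t1" "t1 \<le> t2" "t2 < s + l"
  shows "ennreal (norm (half_curvature s t2 - half_curvature s t1)) \<le> point_energy s"
proof -
  have ne: "f s \<noteq> f t" if "t \<in> {t1..t2}" for t
    by (rule f_neq) (use that assms in auto)
  have "\<forall>t. \<exists>y. t \<in> {t1..t2} \<longrightarrow>
      (half_curvature s has_vector_derivative y) (at t) \<and> norm y = energy_density s t"
    using ne by (metis half_curvature_deriv)
  then obtain y where y: "\<And>t. t \<in> {t1..t2} \<Longrightarrow> (half_curvature s has_vector_derivative y t) (at t)"
    "\<And>t. t \<in> {t1..t2} \<Longrightarrow> norm (y t) = energy_density s t" by metis
  have cont: "continuous_on {t1..t2} (energy_density s)" by (rule energy_density_cont[OF ne])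
  have "(y has_integral half_curvature s t2 - half_curvature s t1) {t1..t2}"
    by (rule fundamental_theorem_of_calculus[OF assms(2)])
      (use y(1) in \<open>auto intro: has_vector_derivative_at_within\<close>)
  then have "norm (half_curvature s t2 - half_curvature s t1) \<le> integral {t1..t2} (energy_density s)"
    using Henstock_Kurzweil_Integration.integral_norm_bound_integral[of y "{t1..t2}" "energy_density s"] y(2)
      integrable_continuous_real[OF cont]
    by (auto simp: has_integral_iff)
  then have "ennreal (norm (half_curvature s t2 - half_curvature s t1))
      \<le> (\<integral>\<^sup>+t. ennreal (energy_density s t) * indicator {t1..t2} t \<partial>lborel)"
    by (subst nn_integral_has_integral_lebesgue'[OF _ integrable_integral[OF integrable_continuous_real[OF cont]]])
      (auto intro: ennreal_leI energy_density_nonneg)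
  also have "\<dots> = emeasure (density lborel (\<lambda>t. ennreal (energy_density s t))) {t1..t2}"
    by (simp add: emeasure_density)
  also have "\<dots> \<le> emeasure (density lborel (\<lambda>t. ennreal (energy_density s t))) {s..<s+l}"
    by (rule emeasure_mono) (use assms in auto)
  also have "\<dots> = point_energy s"
    unfolding point_energy_def
    using emeasure_density_periodic[of "\<lambda>t. ennreal (energy_density s t)" l s 0] l_pos
    by (simp add: energy_density_periodic)
  finally show ?thesis .
qed

lemma half_curvature_variation:
  assumes "0 < \<bar>t1 - s\<bar>" "\<bar>t1 - s\<bar> < l" "0 < \<bar>t2 - s\<bar>" "\<bar>t2 - s\<bar> < l"
  shows "ennreal (norm (half_curvature s t1 - half_curvature s t2)) \<le> point_energy s"
proof -
  have lift: "\<exists>u. s < u \<and> u < s + l \<and> half_curvature s u = half_curvature s t"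
    if "0 < \<bar>t - s\<bar>" "\<bar>t - s\<bar> < l" for t
    using that half_curvature_periodic[of s t]
    by (cases "t > s") (auto intro: exI[of _ t] exI[of _ "t + l"])
  obtain u1 u2 where u: "s < u1" "u1 < s + l" "half_curvature s u1 = half_curvature s t1"
    "s < u2" "u2 < s + l" "half_curvature s u2 = half_curvature s t2"
    using lift assms by metis
  show ?thesis
    using half_curvature_variation_ordered[of s u1 u2] half_curvature_variation_ordered[of s u2 u1] u
    by (cases "u1 \<le> u2") (auto simp: norm_minus_commute)
qed

text \<open>The tangent circles through \<open>f t\<close> converge to the osculating circle.\<close>
lemma half_curvature_tendsto: "(half_curvature s \<longlongrightarrow> k s /\<^sub>R 2) (at s)"
proof -
  let ?q = "\<lambda>t. (f t - f s - (t - s) *\<^sub>R v s) /\<^sub>R (t - s)\<^sup>2"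
  have Q: "(?q \<longlongrightarrow> k s /\<^sub>R 2) (at s)"
    by (rule second_order_quotient_tendsto[OF f_deriv v_deriv])
  have A: "((\<lambda>t. normal_part s (?q t)) \<longlongrightarrow> normal_part s (k s /\<^sub>R 2)) (at s)"
    by (rule bounded_linear.tendsto[OF bounded_linear_normal_part Q])
  have "((\<lambda>t. v s + (t - s) *\<^sub>R ?q t) \<longlongrightarrow> v s + (s - s) *\<^sub>R (k s /\<^sub>R 2)) (at s)"
    by (intro tendsto_intros Q)
  moreover have "\<forall>\<^sub>F t in at s. v s + (t - s) *\<^sub>R ?q t = (f t - f s) /\<^sub>R (t - s)"
  proof -
    have "v s + (t - s) *\<^sub>R ?q t = (f t - f s) /\<^sub>R (t - s)" if "t \<noteq> s" for t
    proof -
      have "(t - s) *\<^sub>R ?q t = (f t - f s - (t - s) *\<^sub>R v s) /\<^sub>R (t - s)"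
        using that by (simp add: power2_eq_square del: scaleR_diff_right)
      then show ?thesis using that by (simp add: scaleR_diff_right)
    qed
    then show ?thesis by (rule eventually_mono[OF eventually_neq_at_within[of s s UNIV]])
  qed
  ultimately have "((\<lambda>t. (f t - f s) /\<^sub>R (t - s)) \<longlongrightarrow> v s + (s - s) *\<^sub>R (k s /\<^sub>R 2)) (at s)"
    by (rule Lim_transform_eventually)
  then have "((\<lambda>t. (f t - f s) /\<^sub>R (t - s)) \<longlongrightarrow> v s) (at s)"
    by simp
  then have B: "((\<lambda>t. (norm ((f t - f s) /\<^sub>R (t - s)))\<^sup>2) \<longlongrightarrow> 1) (at s)"
    using tendsto_power[OF tendsto_norm, where n = 2] by fastforce
  have "((\<lambda>t. normal_part s (?q t) /\<^sub>R (norm ((f t - f s) /\<^sub>R (t - s)))\<^sup>2) \<longlongrightarrow> normal_part s (k s /\<^sub>R 2) /\<^sub>R 1) (at s)"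
    by (rule tendsto_scaleR[OF tendsto_inverse[OF B] A]) simp
  moreover have "\<forall>\<^sub>F t in at s. normal_part s (?q t) /\<^sub>R (norm ((f t - f s) /\<^sub>R (t - s)))\<^sup>2 = half_curvature s t"
  proof -
    have "normal_part s (?q t) /\<^sub>R (norm ((f t - f s) /\<^sub>R (t - s)))\<^sup>2 = half_curvature s t"
      if "t \<noteq> s" for t
    proof -
      have "normal_part s (v s) = 0" by (simp add: normal_part_def)
      then have q: "normal_part s (?q t) = normal_part s (f t - f s) /\<^sub>R (t - s)\<^sup>2"
        by (simp add: linear_simps[OF bounded_linear_normal_part] del: scaleR_diff_right)
      have n: "(norm ((f t - f s) /\<^sub>R (t - s)))\<^sup>2 = (norm (f t - f s))\<^sup>2 / (t - s)\<^sup>2"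
        by (simp only: norm_scaleR power_mult_distrib power2_abs power_inverse divide_inverse mult.commute real_norm_def)
      have "normal_part s (?q t) /\<^sub>R (norm ((f t - f s) /\<^sub>R (t - s)))\<^sup>2
          = (normal_part s (f t - f s) /\<^sub>R (t - s)\<^sup>2) /\<^sub>R ((norm (f t - f s))\<^sup>2 / (t - s)\<^sup>2)"
        by (simp only: q n)
      also have "\<dots> = normal_part s (f t - f s) /\<^sub>R (norm (f t - f s))\<^sup>2" using that by (simp add: inverse_eq_divide)
      finally show ?thesis
        by (simp only: half_curvature_def inverted_def linear_simps(5)[OF bounded_linear_normal_part])
    qed
    then show ?thesis by (rule eventually_mono[OF eventually_neq_at_within[of s s UNIV]])
  qed
  ultimately have "(half_curvature s \<longlongrightarrow> normal_part s (k s /\<^sub>R 2) /\<^sub>R 1) (at s)"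
    by (rule Lim_transform_eventually)
  moreover have "normal_part s (k s /\<^sub>R 2) /\<^sub>R 1 = k s /\<^sub>R 2"
    by (simp add: normal_part_def inner_commute[of "k s" "v s"])
  ultimately show ?thesis by simp
qed

lemma half_curvature_deviation:
  assumes "0 < \<bar>t - s\<bar>" "\<bar>t - s\<bar> < l"
  shows "ennreal (norm (k s /\<^sub>R 2 - half_curvature s t)) \<le> point_energy s"
proof (rule tendsto_upperbound)
  show "((\<lambda>u. ennreal (norm (half_curvature s u - half_curvature s t)))
      \<longlongrightarrow> ennreal (norm (k s /\<^sub>R 2 - half_curvature s t))) (at s)"
    by (intro tendsto_intros tendsto_ennrealI half_curvature_tendsto)
  have "\<forall>\<^sub>F u in at s. u \<noteq> s \<and> dist u s < l"
    using l_pos eventually_at by blast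
  then show "\<forall>\<^sub>F u in at s. ennreal (norm (half_curvature s u - half_curvature s t)) \<le> point_energy s"
    by eventually_elim (use assms in \<open>auto intro!: half_curvature_variation simp: dist_real_def\<close>)
qed simp

subsection \<open>Repulsion of strands\<close>

text \<open>
  Let \<open>\<phi> s = |f s - f t|\<close> and let \<open>w\<close> be half the difference between the curvature vectors at \<open>f s\<close> of
  the osculating circle and of the tangent circle through \<open>f t\<close>. Then
  \<open>\<phi>'' = - (1 - \<phi>'\<^sup>2) / \<phi> + 2 (w \<bullet> (f s - f t)) / \<phi>\<close>, and \<open>|w|\<close> is bounded by the point energy. So the
  lower bound for almost concave functions applies, with \<open>\<eta>\<close> twice the bound on the energy of the arc.
\<close>
lemma repulsion:
  assumes L: "L > 0" and small: "energy_measure {m-L..m+L} \<le> ennreal (1 / 100)"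
    and t: "\<And>s. s \<in> {m-L..m+L} \<Longrightarrow> 0 < \<bar>t - s\<bar> \<and> \<bar>t - s\<bar> < l"
  shows "L \<le> 7 * norm (f m - f t)"
proof -
  define g where "g s = f s - f t" for s
  define \<phi> where "\<phi> s = norm (g s)" for s
  define \<psi> where "\<psi> s = (g s \<bullet> v s) / \<phi> s" for s
  define w where "w s = k s /\<^sub>R 2 - half_curvature s t" for s
  let ?I = "{m-L..m+L}"
  have pos: "\<phi> s > 0" if "s \<in> ?I" for s
    using f_neq[of t s] t[OF that] by (auto simp: \<phi>_def g_def)
  have \<phi>2: "\<phi> s * \<phi> s = g s \<bullet> g s" for s
    by (simp add: \<phi>_def power2_norm_eq_inner[symmetric] power2_eq_square)
  have g_deriv: "(g has_vector_derivative v s) (at s)" for s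
    unfolding g_def[abs_def] by (auto intro!: derivative_eq_intros f_deriv)
  have \<phi>_deriv: "(\<phi> has_real_derivative \<psi> s) (at s)" if "s \<in> ?I" for s
  proof -
    have "((\<lambda>s. g s \<bullet> g s) has_vector_derivative (g s \<bullet> v s + v s \<bullet> g s)) (at s)"
      by (rule bounded_bilinear.has_vector_derivative[OF bounded_bilinear_inner g_deriv g_deriv])
    then have "((\<lambda>s. g s \<bullet> g s) has_real_derivative (2 * (g s \<bullet> v s))) (at s)"
      by (simp add: inner_commute has_real_derivative_iff_has_vector_derivative)
    moreover have "g s \<bullet> g s > 0" using pos[OF that] by (simp add: \<phi>_def)
    ultimately have "((\<lambda>s. sqrt (g s \<bullet> g s)) has_real_derivative
        (inverse (sqrt (g s \<bullet> g s)) / 2 * (2 * (g s \<bullet> v s)))) (at s)"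
      by (rule DERIV_chain2[where f = sqrt, OF DERIV_real_sqrt, rotated])
    moreover have "inverse (sqrt (g s \<bullet> g s)) / 2 * (2 * (g s \<bullet> v s)) = \<psi> s"
      unfolding \<psi>_def \<phi>_def norm_eq_sqrt_inner by (simp add: field_simps)
    ultimately show ?thesis unfolding \<phi>_def[abs_def] norm_eq_sqrt_inner by simp
  qed
  have \<psi>_deriv: "(\<psi> has_real_derivative ((1 + g s \<bullet> k s) / \<phi> s - (\<psi> s)\<^sup>2 / \<phi> s)) (at s)"
    if "s \<in> ?I" for s
  proof -
    have "((\<lambda>s. g s \<bullet> v s) has_vector_derivative (g s \<bullet> k s + v s \<bullet> v s)) (at s)"
      by (rule bounded_bilinear.has_vector_derivative[OF bounded_bilinear_inner g_deriv v_deriv])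
    then have "((\<lambda>s. g s \<bullet> v s) has_real_derivative (1 + g s \<bullet> k s)) (at s)"
      by (simp add: has_real_derivative_iff_has_vector_derivative add.commute)
    from DERIV_divide[OF this \<phi>_deriv[OF that]] pos[OF that]
    have "(\<psi> has_real_derivative ((1 + g s \<bullet> k s) * \<phi> s - (g s \<bullet> v s) * \<psi> s) / (\<phi> s * \<phi> s)) (at s)"
      by (simp add: \<psi>_def[abs_def])
    moreover have "g s \<bullet> v s = \<psi> s * \<phi> s" using pos[OF that] by (simp add: \<psi>_def)
    ultimately show ?thesis
      using pos[OF that] by (simp add: diff_divide_distrib power2_eq_square)
  qed
  have slope: "\<bar>\<psi> s\<bar> \<le> 1" if "s \<in> ?I" for s
    using Cauchy_Schwarz_ineq2[of "g s" "v s"] pos[OF that] by (simp add: \<psi>_def \<phi>_def abs_divide)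
  have ode: "(1 + g s \<bullet> k s) / \<phi> s - (\<psi> s)\<^sup>2 / \<phi> s \<le> 2 * norm (w s) - (1 - (\<psi> s)\<^sup>2) / \<phi> s"
    if "s \<in> ?I" for s
  proof -
    have gv: "g s \<bullet> v s = \<psi> s * \<phi> s" using pos[OF that] by (simp add: \<psi>_def)
    have "half_curvature s t = (- 1 / (\<phi> s * \<phi> s)) *\<^sub>R normal_part s (g s)"
      by (simp add: half_curvature_def inverted_def \<phi>_def g_def norm_minus_commute power2_eq_square
          linear_simps[OF bounded_linear_normal_part] scaleR_diff_right inverse_eq_divide)
    moreover have "normal_part s (g s) \<bullet> g s = (1 - (\<psi> s)\<^sup>2) * (\<phi> s * \<phi> s)"
      by (simp add: normal_part_def inner_simps gv \<phi>2[symmetric] inner_commute[of "v s"])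
        (simp add: power2_eq_square algebra_simps)
    ultimately have "w s \<bullet> g s = (g s \<bullet> k s) / 2 + (1 - (\<psi> s)\<^sup>2)"
      using pos[OF that] by (simp add: w_def inner_simps inner_commute)
    moreover have "w s \<bullet> g s \<le> norm (w s) * \<phi> s" unfolding \<phi>_def by (rule norm_cauchy_schwarz)
    ultimately have "1 + g s \<bullet> k s - (\<psi> s)\<^sup>2 \<le> 2 * norm (w s) * \<phi> s - (1 - (\<psi> s)\<^sup>2)" by simp
    then have "(1 + g s \<bullet> k s - (\<psi> s)\<^sup>2) / \<phi> s \<le> (2 * norm (w s) * \<phi> s - (1 - (\<psi> s)\<^sup>2)) / \<phi> s"
      using pos[OF that] by (intro divide_right_mono) auto
    then show ?thesis using pos[OF that] by (simp add: diff_divide_distrib)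
  qed
  have w_cont: "continuous_on ?I w"
    unfolding w_def half_curvature_def inverted_def normal_part_def
    by (intro continuous_intros f_cont v_cont continuous_on_subset[OF k_cont])
      (use pos in \<open>auto simp: \<phi>_def g_def norm_minus_commute\<close>)
  have "ennreal (integral ?I (\<lambda>s. norm (w s))) = (\<integral>\<^sup>+s. ennreal (norm (w s)) * indicator ?I s \<partial>lborel)"
    by (rule nn_integral_has_integral_lebesgue'[symmetric])
      (auto intro!: integrable_integral integrable_continuous_real continuous_intros w_cont)
  also have "\<dots> \<le> (\<integral>\<^sup>+s. point_energy s * indicator ?I s \<partial>lborel)"
    by (intro nn_integral_mono) (use half_curvature_deviation t in \<open>auto simp: w_def split: split_indicator\<close>)
  also have "\<dots> = energy_measure ?I" by (simp add: energy_measure_def emeasure_density)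
  finally have "integral ?I (\<lambda>s. norm (w s)) \<le> 1 / 100"
    using small by (meson ennreal_le_iff order_trans zero_le_divide_1_iff zero_le_numeral)
  then have "integral ?I (\<lambda>s. 2 * norm (w s)) \<le> 1 / 50" by simp
  moreover have "continuous_on ?I (\<lambda>s. 2 * norm (w s))" by (intro continuous_intros w_cont)
  ultimately show ?thesis
    using almost_concave_lower_bound[of L "1/50" m \<phi> \<psi> "\<lambda>s. (1 + g s \<bullet> k s) / \<phi> s - (\<psi> s)\<^sup>2 / \<phi> s"
        "\<lambda>s. 2 * norm (w s)"] L pos \<phi>_deriv \<psi>_deriv slope ode
    by (auto simp: \<phi>_def g_def)
qed

subsection \<open>Energy at a near double point\<close>

lemma exists_point_of_small_energy:
  assumes "a < b" and "energy_measure {a..b} < ennreal (\<tau> * (b - a))" "\<tau> \<ge> 0"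
  obtains s where "s \<in> {a..b}" "point_energy s \<le> ennreal \<tau>"
proof (rule ccontr)
  assume no: "\<not> thesis"
  have large: "point_energy s \<ge> ennreal \<tau>" if "s \<in> {a..b}" for s
    using no \<open>\<And>s. s \<in> {a..b} \<Longrightarrow> point_energy s \<le> ennreal \<tau> \<Longrightarrow> thesis\<close> that by (meson linear)
  have "ennreal (\<tau> * (b - a)) = (\<integral>\<^sup>+s. ennreal \<tau> * indicator {a..b} s \<partial>lborel)"
    using assms(1,3) by (simp add: nn_integral_cmult ennreal_mult)
  also have "\<dots> \<le> (\<integral>\<^sup>+s. point_energy s * indicator {a..b} s \<partial>lborel)"
    by (intro nn_integral_mono) (use large in \<open>auto split: split_indicator\<close>)
  also have "\<dots> = energy_measure {a..b}" by (simp add: energy_measure_def emeasure_density)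
  finally show False using assms(2) by simp
qed

text \<open>
  Otherwise some point \<open>f s\<close> on the forward strand of \<open>f s0\<close>, at arc-length between \<open>2500 r\<close> and
  \<open>5000 r\<close> from it, has point energy at most \<open>1 / (8 * 10\<^sup>8 * r)\<close>, because \<open>1 / 400000\<close> is less than
  \<open>2500 r\<close> times this value. By repulsion \<open>f s\<close> has distance at least \<open>300 r\<close> from \<open>f s0\<close>, by
  arc-length at most \<open>5000 r\<close>, so the tube in which \<open>f s\<close> sees the knot is thin enough to exclude
  three strands.
\<close>
lemma window_energy:
  assumes r: "r > 0" and close: "norm (f s0 - f t0) \<le> r"
    and sep: "s0 + 10000 * r < t0 - 10000 * r" "t0 + 10000 * r < s0 - 10000 * r + l"
  shows "energy_measure ({s0+r..s0+10000*r} \<union> {s0-10000*r..s0-r} \<union> {t0+r..t0+10000*r}) \<ge> ennreal (1/400000)"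
    (is "energy_measure ?J \<ge> _")
proof (rule ccontr)
  assume "\<not> ?thesis"
  then have small: "energy_measure ?J < ennreal (1/400000)" by simp
  define R where "R = 10000 * r"
  \<comment> \<open>Strand \<open>i\<close> has parameters \<open>q i \<rho>\<close> for \<open>\<rho>\<close> in \<open>{r..R}\<close>, starting from the centre \<open>c i\<close>; strand 1 runs
    backwards.\<close>
  define c where "c i = (if i = (2::nat) then t0 else s0)" for i
  define \<epsilon> :: "nat \<Rightarrow> real" where "\<epsilon> i = (if i = 1 then - 1 else 1)" for i
  define q where "q i \<rho> = c i + \<epsilon> i * \<rho>" for i \<rho>
  define I where "I i = (if i = 0 then {s0+r..s0+R} else if i = 1 then {s0-R..s0-r} else {t0+r..t0+R})" for i :: nat
  have three: "i = 0 \<or> i = 1 \<or> i = 2" if "i < 3" for i :: nat using that by auto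
  have rep: "\<rho> - r \<le> 7 * norm (f (q i \<rho>) - f t)"
    if i: "i < 3" and \<rho>: "\<rho> \<in> {r..R/2}" and t: "t \<in> {s0-R..t0+R} - I i" for i \<rho> t
  proof (cases "\<rho> = r")
    case False
    have sub: "{q i \<rho> - (\<rho> - r)..q i \<rho> + (\<rho> - r)} \<subseteq> I i"
      using three[OF i] \<rho> r by (auto simp: q_def \<epsilon>_def I_def c_def)
    have IJ: "I i \<subseteq> ?J" using three[OF i] by (auto simp: I_def R_def)
    show ?thesis
    proof (rule repulsion)
      have "energy_measure {q i \<rho> - (\<rho> - r)..q i \<rho> + (\<rho> - r)} \<le> energy_measure ?J"
        by (rule emeasure_mono) (use sub IJ in auto)
      also have "\<dots> \<le> ennreal (1 / 400000)" using small by simp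
      also have "\<dots> \<le> ennreal (1 / 100)" by (rule ennreal_leI) simp
      finally show "energy_measure {q i \<rho> - (\<rho> - r)..q i \<rho> + (\<rho> - r)} \<le> ennreal (1 / 100)" .
      fix s assume "s \<in> {q i \<rho> - (\<rho> - r)..q i \<rho> + (\<rho> - r)}"
      then have s: "s \<in> I i" using sub by auto
      then have "s \<in> {s0-R..t0+R}" using three[OF i] r sep by (auto simp: I_def R_def)
      then show "0 < \<bar>t - s\<bar> \<and> \<bar>t - s\<bar> < l" using s t sep by (auto simp: R_def)
    qed (use \<rho> False in auto)
  qed simp
  have q_mem: "q j \<rho> \<in> {s0-R..t0+R} - I i" if "i < 3" "j < 3" "i \<noteq> j" "\<rho> \<in> {r..R}" for i j \<rho>
    using three[OF that(1)] three[OF that(2)] that(3,4) r sep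
    by (auto simp: q_def \<epsilon>_def I_def c_def R_def)
  have c_mem: "c i \<in> {s0-R..t0+R} - I i" if "i < 3" for i
    using three[OF that] r sep by (auto simp: I_def c_def R_def)
  obtain s where s: "s \<in> {s0 + 2500 * r..s0 + 5000 * r}" "point_energy s \<le> ennreal (1 / (800000000 * r))"
  proof (rule exists_point_of_small_energy)
    have "energy_measure {s0 + 2500 * r..s0 + 5000 * r} \<le> energy_measure ?J"
      by (rule emeasure_mono) (use r in auto)
    also have "\<dots> < ennreal (1 / 400000)" by (rule small)
    also have "\<dots> \<le> ennreal (1 / (800000000 * r) * (s0 + 5000 * r - (s0 + 2500 * r)))"
      by (rule ennreal_leI) (use r in simp)
    finally show "energy_measure {s0 + 2500 * r..s0 + 5000 * r}
        < ennreal (1 / (800000000 * r) * (s0 + 5000 * r - (s0 + 2500 * r)))" .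
  qed (use r in auto)
  have D_upper: "norm (f s0 - f s) \<le> 5000 * r"
    using f_lipschitz[of s0 s] s(1) r by auto
  show False
  proof (rule three_strands_in_tube_False[of r "f s0" "f s" "v s" "1 / (800000000 * r)" "\<lambda>i \<rho>. f (q i \<rho>)"])
    show "r > 0" by (rule r)
    have "s - s0 - r \<le> 7 * norm (f s - f s0)"
      using rep[of 0 "s - s0" s0] c_mem[of 0] s(1) r by (simp add: q_def \<epsilon>_def c_def R_def)
    then show "300 * r \<le> norm (f s0 - f s)" using s(1) r by (simp add: norm_minus_commute)
    have "(norm (f s0 - f s))\<^sup>2 \<le> (5000 * r)\<^sup>2" using D_upper by (intro power_mono) auto
    then have "1 / (800000000 * r) * (norm (f s0 - f s))\<^sup>2 \<le> 1 / (800000000 * r) * (5000 * r)\<^sup>2"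
      using r by (intro mult_left_mono) auto
    also have "\<dots> = r / 32" using r by (simp add: power2_eq_square field_simps)
    finally show "28 * (1 / (800000000 * r) * (norm (f s0 - f s))\<^sup>2) < r" using r by simp
    fix i :: nat assume i: "i < 3"
    show "continuous_on {r..200 * r} (\<lambda>\<rho>. f (q i \<rho>))"
      by (rule continuous_on_compose2[OF f_cont[of UNIV]]) (auto simp: q_def intro!: continuous_intros)
    have c_near: "norm (f (c i) - f s0) \<le> r"
      using close r by (simp add: c_def norm_minus_commute)
    have "199 * r \<le> 7 * norm (f (q i (200 * r)) - f (c i))"
      using rep[OF i _ c_mem[OF i], of "200 * r"] r by (simp add: R_def)
    then show "27 * r \<le> norm (f (q i (200 * r)) - f s0)"
      using norm_triangle_ineq4[of "f (q i (200 * r)) - f s0" "f (c i) - f s0"] c_near r by simp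
    fix \<rho> assume \<rho>: "\<rho> \<in> {r..200 * r}"
    show "norm (f (q i \<rho>) - f s0) \<le> \<rho> + r"
      using norm_triangle_ineq[of "f (q i \<rho>) - f (c i)" "f (c i) - f s0"] c_near
        f_lipschitz[of "q i \<rho>" "c i"] \<rho> r by (auto simp: q_def \<epsilon>_def split: if_splits)
    have "ennreal (norm (half_curvature s (q i \<rho>) - half_curvature s s0)) \<le> point_energy s"
      by (rule half_curvature_variation)
        (use three[OF i] \<rho> s(1) r sep in \<open>auto simp: q_def \<epsilon>_def c_def\<close>)
    also note s(2)
    finally have "norm (half_curvature s (q i \<rho>) - half_curvature s s0) \<le> 1 / (800000000 * r)"
      using r by (subst (asm) ennreal_le_iff) auto
    then show "norm (((f (q i \<rho>) - f s) /\<^sub>R (norm (f (q i \<rho>) - f s))\<^sup>2 - (f s0 - f s) /\<^sub>R (norm (f s0 - f s))\<^sup>2)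
       - (((f (q i \<rho>) - f s) /\<^sub>R (norm (f (q i \<rho>) - f s))\<^sup>2 - (f s0 - f s) /\<^sub>R (norm (f s0 - f s))\<^sup>2) \<bullet> v s) *\<^sub>R v s)
       \<le> 1 / (800000000 * r)"
      unfolding half_curvature_def linear_simps(2)[OF bounded_linear_normal_part, symmetric]
      by (simp only: normal_part_def inverted_def)
    fix j \<rho>' assume j: "j < 3" "i \<noteq> j" "\<rho>' \<in> {r..200 * r}"
    show "\<rho> - r \<le> 7 * norm (f (q i \<rho>) - f (q j \<rho>'))"
      by (rule rep[OF i _ q_mem[OF i j(1,2)]]) (use \<rho> j r in \<open>auto simp: R_def\<close>)
  qed simp
qed

lemma energy_eq_energy_measure:
  assumes v: "v = unit_tangent f"
  shows "abs_imaginary_cross_ratio_energy l f = energy_measure {0..<l}"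
proof -
  have dens: "\<bar>sin (conformal_angle f s t)\<bar> / (norm (f s - f t))\<^sup>2 = energy_density s t"
    if "f s \<noteq> f t" for s t
  proof -
    define d where "d = f s - f t"
    define c where "c = v s \<bullet> ((2 * (d \<bullet> v t) / (d \<bullet> d)) *\<^sub>R d - v t)"
    have c: "\<bar>c\<bar> \<le> 1"
      using Cauchy_Schwarz_ineq2[of "v s" "(2 * (d \<bullet> v t) / (d \<bullet> d)) *\<^sub>R d - v t"]
      by (simp add: c_def norm_reflection)
    have "conformal_angle f s t = arccos c"
      using conformal_angle_eq[of f s t] that by (simp add: v[symmetric] c_def d_def Let_def)
    then have "\<bar>sin (conformal_angle f s t)\<bar> = sqrt (1 - c\<^sup>2)"
      using c by (simp add: sin_arccos abs_le_iff abs_square_le_1)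
    then show ?thesis by (simp add: energy_density_def Let_def c_def d_def)
  qed
  have "abs_imaginary_cross_ratio_energy l f =
    (\<integral>\<^sup>+z. (\<lambda>(s, t). ennreal (energy_density s t) * indicator {0..<l} t * indicator {0..<l} s) z
      \<partial>(lborel \<Otimes>\<^sub>M lborel))"
    unfolding abs_imaginary_cross_ratio_energy_def
  proof (rule nn_integral_cong)
    fix z :: "real \<times> real"
    obtain s t where z: "z = (s, t)" by (cases z)
    have "energy_density s s = 0" by (simp add: energy_density_def)
    moreover have "f s \<noteq> f t" if "s \<noteq> t" "s \<in> {0..<l}" "t \<in> {0..<l}"
      using that inj_onD[OF f_inj] by blast
    ultimately show "ennreal (case z of (s, t) \<Rightarrow> \<bar>sin (conformal_angle f s t)\<bar> / (norm (f s - f t))\<^sup>2) *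
        indicator ({0..<l} \<times> {0..<l} - {(s, t). s = t}) z =
      (case z of (s, t) \<Rightarrow> ennreal (energy_density s t) * indicator {0..<l} t * indicator {0..<l} s)"
      using dens[of s t] unfolding z by (cases "s = t") (auto split: split_indicator)
  qed
  also have "\<dots> = (\<integral>\<^sup>+s. \<integral>\<^sup>+t. ennreal (energy_density s t) * indicator {0..<l} t * indicator {0..<l} s
      \<partial>lborel \<partial>lborel)"
    by (subst lborel.nn_integral_fst[symmetric]) simp_all
  also have "\<dots> = (\<integral>\<^sup>+s. point_energy s * indicator {0..<l} s \<partial>lborel)"
    by (simp add: nn_integral_multc point_energy_def emeasure_density)
  also have "\<dots> = energy_measure {0..<l}"
    by (simp add: energy_measure_def emeasure_density)
  finally show ?thesis .
qed

text \<open>Consecutive scales differ by a factor \<open>20000\<close>, twice the width \<open>10000\<close> of a window, so that the closed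
  windows are disjoint.\<close>
lemma many_windows_energy:
  fixes N :: nat and r s0 t0 :: real
  defines "A \<equiv> 20000 ^ N * r"
  assumes r: "r > 0" and close: "norm (f s0 - f t0) \<le> r"
    and sep: "s0 + A \<le> t0 - A" "t0 + A \<le> s0 - A + l"
  shows "energy_measure {0..<l} \<ge> ennreal (real N / 400000)"
proof -
  define R where "R n = 20000 ^ n * r" for n :: nat
  define J where "J n = {s0 + R n..s0 + 10000 * R n} \<union> {s0 - 10000 * R n..s0 - R n}
      \<union> {t0 + R n..t0 + 10000 * R n}" for n
  have R: "R n \<ge> r" for n
    using r by (simp add: R_def)
  have R_less: "20000 * R m \<le> R n" if "m < n" for m n
  proof -
    have "(20000::real) ^ Suc m \<le> 20000 ^ n" using that by (intro power_increasing) auto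
    then show ?thesis using mult_right_mono[of "20000 ^ Suc m" "20000 ^ n" r] r by (simp add: R_def)
  qed
  have RA: "20000 * R n \<le> A" if "n < N" for n using R_less[OF that] by (simp add: R_def A_def)
  \<comment> \<open>The arc-length from the nearer of the two centres tells to which window a parameter belongs.\<close>
  define g where "g s = (if s \<le> s0 + A then \<bar>s - s0\<bar> else \<bar>s - t0\<bar>)" for s
  have A: "A > 0" using r by (simp add: A_def)
  have g: "R n \<le> g s \<and> g s \<le> 10000 * R n" if "s \<in> J n" "n < N" for s n
    using that(1) RA[OF that(2)] R[of n] r A sep by (auto simp: J_def g_def)
  have meas: "J n \<in> sets borel" for n by (simp add: J_def)
  have disj: "disjoint_family_on J {..<N}"
    unfolding disjoint_family_on_def
  proof (intro ballI impI)
    fix m n assume mn: "m \<in> {..<N}" "n \<in> {..<N}" "m \<noteq> n"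
    show "J m \<inter> J n = {}"
    proof (rule ccontr)
      assume "J m \<inter> J n \<noteq> {}"
      then obtain s where "s \<in> J m" "s \<in> J n" by auto
      then show False
        using g[of s m] g[of s n] mn R_less[of m n] R_less[of n m] R[of m] R[of n] r
        by (cases m n rule: linorder_cases) auto
    qed
  qed
  have window: "ennreal (1 / 400000) \<le> energy_measure (J n)" if "n < N" for n
    unfolding J_def
  proof (rule window_energy)
    show "R n > 0" "norm (f s0 - f t0) \<le> R n" using R[of n] r close by auto
    show "s0 + 10000 * R n < t0 - 10000 * R n" "t0 + 10000 * R n < s0 - 10000 * R n + l"
      using RA[OF that] R[of n] r sep by auto
  qed
  have "ennreal (real N / 400000) = (\<Sum>n<N. ennreal (1 / 400000))"
    by (subst sum_ennreal) auto
  also have "\<dots> \<le> (\<Sum>n<N. energy_measure (J n))"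
    by (intro sum_mono) (use window in auto)
  also have "\<dots> = energy_measure (\<Union>n\<in>{..<N}. J n)"
    by (rule sum_emeasure) (use disj meas in auto)
  also have "\<dots> \<le> energy_measure {s0 - A..<s0 - A + l}"
  proof (rule emeasure_mono)
    show "(\<Union>n\<in>{..<N}. J n) \<subseteq> {s0 - A..<s0 - A + l}"
    proof (rule UN_least)
      fix n assume "n \<in> {..<N}"
      then show "J n \<subseteq> {s0 - A..<s0 - A + l}"
        using RA[of n] R[of n] r A sep by (auto simp: J_def)
    qed
  qed simp
  also have "\<dots> = energy_measure {0..<l}"
    using energy_measure_period[of "s0 - A" 0] by simp
  finally show ?thesis .
qed

end

section \<open>Knots with a near double point\<close>

lemma unit_speed_knot_of_arclength_knot:
  assumes "arclength_knot l f"
  obtains k where "unit_speed_knot l f (unit_tangent f) k"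
proof -
  obtain f' f'' where d: "\<And>s. (f has_vector_derivative f' s) (at s)"
    "\<And>s. (f' has_vector_derivative f'' s) (at s)" "continuous_on UNIV f''"
    using assms unfolding arclength_knot_def C2_curve_def by blast
  have "unit_tangent f = f'"
    by (rule ext) (simp add: unit_tangent_def vector_derivative_at[OF d(1)])
  with assms d have "unit_speed_knot l f (unit_tangent f) f''"
    by (auto simp: unit_speed_knot_def arclength_knot_def)
  then show ?thesis by (rule that)
qed

theorem theorem5p2p4:
  fixes b \<delta> \<kappa>\<^sub>0 :: real
  assumes "0 < \<delta>" and "\<delta> \<le> 1 / 2"
  shows "\<exists>C > 0. \<forall>(l :: real) (f :: real \<Rightarrow> real ^ 3).
           arclength_knot l f \<and> (\<forall>s. curvature f s \<le> \<kappa>\<^sub>0) \<and>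
           (\<exists>s \<in> {0..<l}. \<exists>t \<in> {0..<l}. arc_dist l s t = \<delta> * l \<and> norm (f s - f t) \<le> C * l)
           \<longrightarrow> abs_imaginary_cross_ratio_energy l f \<ge> ennreal b"
proof -
  obtain N :: nat where N: "400000 * b \<le> real N" using real_arch_simple by blast
  define C where "C = \<delta> / (2 * 20000 ^ N)"
  have C: "C > 0" using assms by (simp add: C_def)
  have CN: "20000 ^ N * (C * l) = \<delta> * l / 2" for l by (simp add: C_def)
  have bound: "ennreal b \<le> abs_imaginary_cross_ratio_energy l f"
    if knot: "arclength_knot l f" and st: "s < t" "arc_dist l s t = \<delta> * l" "norm (f s - f t) \<le> C * l"
    for l s t :: real and f :: "real \<Rightarrow> real ^ 3"
  proof -
    obtain k where "unit_speed_knot l f (unit_tangent f) k"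
      using unit_speed_knot_of_arclength_knot[OF knot] .
    then interpret unit_speed_knot l f "unit_tangent f" k .
    have "ennreal b \<le> ennreal (real N / 400000)" using N by (intro ennreal_leI) simp
    also have "\<dots> \<le> energy_measure {0..<l}"
    proof (rule many_windows_energy)
      show "C * l > 0" using C l_pos by simp
      have "\<delta> * l \<le> t - s" "\<delta> * l \<le> l - (t - s)"
        using st assms(2) by (auto simp: arc_dist_def min_def split: if_splits)
      then show "s + 20000 ^ N * (C * l) \<le> t - 20000 ^ N * (C * l)"
        "t + 20000 ^ N * (C * l) \<le> s - 20000 ^ N * (C * l) + l"
        unfolding CN by auto
    qed (rule st(3))
    also have "\<dots> = abs_imaginary_cross_ratio_energy l f"
      by (rule energy_eq_energy_measure[symmetric]) simp
    finally show ?thesis .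
  qed
  show ?thesis
  proof (intro exI[of _ C] conjI allI impI)
    fix l :: real and f :: "real \<Rightarrow> real ^ 3"
    assume asm: "arclength_knot l f \<and> (\<forall>s. curvature f s \<le> \<kappa>\<^sub>0) \<and>
        (\<exists>s \<in> {0..<l}. \<exists>t \<in> {0..<l}. arc_dist l s t = \<delta> * l \<and> norm (f s - f t) \<le> C * l)"
    then obtain s t where st: "arc_dist l s t = \<delta> * l" "norm (f s - f t) \<le> C * l" by blast
    have "l > 0" using asm by (simp add: arclength_knot_def)
    then have "\<delta> * l > 0" using assms by simp
    then consider "s < t" | "t < s" using st(1) \<open>l > 0\<close> by (cases s t rule: linorder_cases) (auto simp: arc_dist_def)
    then show "ennreal b \<le> abs_imaginary_cross_ratio_energy l f"
    proof cases
      case 1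
      then show ?thesis using bound st asm by blast
    next
      case 2
      have "arc_dist l t s = \<delta> * l" "norm (f t - f s) \<le> C * l"
        using st by (simp_all add: arc_dist_def abs_minus_commute norm_minus_commute)
      then show ?thesis using bound 2 asm by blast
    qed
  qed (rule C)
qed

end
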